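(* For all $a,b,c\ge 0$, the minimal $Q$-free resolution of $Q/I_{L(a,b,c)}$ admits the structure of a differential graded algebra.
   Context: $L(a,b,c)$ is the graph with vertex set $\{x,y\}\cup\{x_i\}_{i=1}^a\cup\{y_j\}_{j=1}^b\cup\{z_k\}_{k=1}^c$ and edges $\{x,y\}$, $\{x,x_i\}$, $\{y,y_j\}$, $\{x,z_k\},\{y,z_k\}$; $Q$ is the polynomial ring over a field $\Bbbk$ in these vertices, and $I_{L(a,b,c)}$ is its edge ideal. (These are exactly the graphs whose edge ideals have a minimal Lyubeznik resolution.) A differential graded (dg) algebra structure on a complex of free $Q$-modules is a unital associative multiplication satisfying $\mathcal{A}_i\mathcal{A}_j\subseteq\mathcal{A}_{i+j}$, $ab=(-1)^{|a||b|}ba$, $a^2=0$ for $|a|$ odd, and the Leibniz rule $\partial(ab)=\partial(a)b+(-1)^{|a|}a\partial(b)$. *)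

theory Defs
  imports Main "HOL-Library.Poly_Mapping"
begin

datatype vtx = VX | VY | VXi nat | VYj nat | VZk nat

definition Lverts :: "nat \<Rightarrow> nat \<Rightarrow> nat \<Rightarrow> vtx set" where
  "Lverts a b c = {VX, VY} \<union> VXi ` {1..a} \<union> VYj ` {1..b} \<union> VZk ` {1..c}"

text \<open>Edges of L(a,b,c), as (unordered) pairs written once.\<close>
definition Ledges :: "nat \<Rightarrow> nat \<Rightarrow> nat \<Rightarrow> (vtx \<times> vtx) set" where
  "Ledges a b c = {(VX, VY)} \<union> (\<lambda>i. (VX, VXi i)) ` {1..a} \<union> (\<lambda>j. (VY, VYj j)) ` {1..b}
     \<union> (\<lambda>k. (VX, VZk k)) ` {1..c} \<union> (\<lambda>k. (VY, VZk k)) ` {1..c}"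

type_synonym 'k mpoly = "(vtx \<Rightarrow>\<^sub>0 nat) \<Rightarrow>\<^sub>0 'k"

definition polyring :: "vtx set \<Rightarrow> ('k::zero) mpoly set" where
  "polyring V = {p :: 'k mpoly. \<forall>m \<in> Poly_Mapping.keys p. Poly_Mapping.keys m \<subseteq> V}"

definition var_mono :: "vtx \<Rightarrow> vtx \<Rightarrow> ('k::{zero,one}) mpoly" where
  "var_mono u v = Poly_Mapping.single (Poly_Mapping.single u 1 + Poly_Mapping.single v 1) 1"

definition edge_ideal :: "nat \<Rightarrow> nat \<Rightarrow> nat \<Rightarrow> ('k::comm_ring_1) mpoly set" where
  "edge_ideal a b c = {(\<Sum>e\<in>Ledges a b c. g e * var_mono (fst e) (snd e)) | g.
      \<forall>e. g e \<in> polyring (Lverts a b c)}"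

definition mdeg :: "(vtx \<Rightarrow>\<^sub>0 nat) \<Rightarrow> nat" where
  "mdeg m = (\<Sum>v\<in>Poly_Mapping.keys m. Poly_Mapping.lookup m v)"

definition homogeneous :: "nat \<Rightarrow> ('k::zero) mpoly \<Rightarrow> bool" where
  "homogeneous t p \<longleftrightarrow> (\<forall>m\<in>Poly_Mapping.keys p. mdeg m = t)"

text \<open>A complex of finitely generated free Q-modules F_i = Q^(r i) (i >= 0);
  elements of F_i are coefficient vectors, zero outside indices < r i.
  The differential F_i -> F_(i-1) (i >= 1) is given by the matrix d i.\<close>
definition fmod :: "vtx set \<Rightarrow> (nat \<Rightarrow> nat) \<Rightarrow> nat \<Rightarrow> (nat \<Rightarrow> ('k::zero) mpoly) set" where
  "fmod V r i = {v. (\<forall>p. v p \<in> polyring V) \<and> (\<forall>p. r i \<le> p \<longrightarrow> v p = 0)}"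

definition diff :: "(nat \<Rightarrow> nat \<Rightarrow> nat \<Rightarrow> ('k::comm_ring_1) mpoly) \<Rightarrow> (nat \<Rightarrow> nat) \<Rightarrow> nat
    \<Rightarrow> (nat \<Rightarrow> 'k mpoly) \<Rightarrow> (nat \<Rightarrow> 'k mpoly)" where
  "diff d r i v = (\<lambda>p. if i = 0 then 0
      else if p < r (i - 1) then (\<Sum>q<r i. d i p q * v q) else 0)"

text \<open>(F, d) with augmentation F_0 = Q -> Q/I is a minimal graded free resolution of Q/I:
  r 0 = 1, entries in Q, exact at every F_i (i >= 1), image of F_1 -> F_0 = Q is I,
  the matrices are homogeneous w.r.t. degrees dg i p of the basis elements (dg 0 0 = 0),
  and minimal: d(F) is contained in mF, m = (vertices), i.e. no entry has a constant term.\<close>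
definition minimal_free_resolution ::
  "vtx set \<Rightarrow> ('k::comm_ring_1) mpoly set \<Rightarrow> (nat \<Rightarrow> nat) \<Rightarrow> (nat \<Rightarrow> nat \<Rightarrow> nat \<Rightarrow> 'k mpoly) \<Rightarrow> bool" where
  "minimal_free_resolution V I r d \<longleftrightarrow>
     r 0 = 1 \<and>
     (\<forall>i p q. 1 \<le> i \<longrightarrow> d i p q \<in> polyring V) \<and>
     (\<lambda>v. v 0) ` (diff d r 1 ` fmod V r 1) = I \<and>
     (\<forall>i\<ge>1. {v \<in> fmod V r i. diff d r i v = (\<lambda>_. 0)} = diff d r (i + 1) ` fmod V r (i + 1)) \<and>
     (\<exists>dg :: nat \<Rightarrow> nat \<Rightarrow> nat. dg 0 0 = 0 \<and>
        (\<forall>i p q. 1 \<le> i \<longrightarrow> p < r (i - 1) \<longrightarrow> q < r i \<longrightarrow>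
           d i p q = 0 \<or> (dg (i - 1) p \<le> dg i q \<and> homogeneous (dg i q - dg (i - 1) p) (d i p q)))) \<and>
     (\<forall>i p q. 1 \<le> i \<longrightarrow> Poly_Mapping.lookup (d i p q) 0 = 0)"

text \<open>A Q-bilinear multiplication F_i x F_j -> F_(i+j), given by structure constants
  mu i j p q s: e^i_p * e^j_q = sum_s mu i j p q s * e^(i+j)_s.\<close>
definition mult :: "(nat \<Rightarrow> nat) \<Rightarrow> (nat \<Rightarrow> nat \<Rightarrow> nat \<Rightarrow> nat \<Rightarrow> nat \<Rightarrow> ('k::comm_ring_1) mpoly)
    \<Rightarrow> nat \<Rightarrow> nat \<Rightarrow> (nat \<Rightarrow> 'k mpoly) \<Rightarrow> (nat \<Rightarrow> 'k mpoly) \<Rightarrow> (nat \<Rightarrow> 'k mpoly)" where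
  "mult r mu i j v w = (\<lambda>s. if s < r (i + j)
      then (\<Sum>p<r i. \<Sum>q<r j. v p * w q * mu i j p q s) else 0)"

definition dg_algebra_structure ::
  "vtx set \<Rightarrow> (nat \<Rightarrow> nat) \<Rightarrow> (nat \<Rightarrow> nat \<Rightarrow> nat \<Rightarrow> ('k::comm_ring_1) mpoly)
     \<Rightarrow> (nat \<Rightarrow> nat \<Rightarrow> nat \<Rightarrow> nat \<Rightarrow> nat \<Rightarrow> 'k mpoly) \<Rightarrow> bool" where
  "dg_algebra_structure V r d mu \<longleftrightarrow>
     (\<forall>i j p q s. mu i j p q s \<in> polyring V) \<and>
     (\<exists>u \<in> fmod V r 0. \<forall>j. \<forall>v \<in> fmod V r j. mult r mu 0 j u v = v \<and> mult r mu j 0 v u = v) \<and>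
     (\<forall>i j k. \<forall>v \<in> fmod V r i. \<forall>w \<in> fmod V r j. \<forall>x \<in> fmod V r k.
        mult r mu (i + j) k (mult r mu i j v w) x = mult r mu i (j + k) v (mult r mu j k w x)) \<and>
     (\<forall>i j. \<forall>v \<in> fmod V r i. \<forall>w \<in> fmod V r j.
        mult r mu i j v w = (\<lambda>s. (-1) ^ (i * j) * mult r mu j i w v s)) \<and>
     (\<forall>i. odd i \<longrightarrow> (\<forall>v \<in> fmod V r i. mult r mu i i v v = (\<lambda>_. 0))) \<and>
     (\<forall>i j. \<forall>v \<in> fmod V r i. \<forall>w \<in> fmod V r j.
        diff d r (i + j) (mult r mu i j v w) =
          (\<lambda>s. mult r mu (i - 1) j (diff d r i v) w s
               + (-1) ^ i * mult r mu i (j - 1) v (diff d r j w) s))"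

end

theory Submission
  imports Defs "HOL-Library.Countable_Set"
begin

text \<open>
  Write \<open>K\<close> for the Koszul algebra on \<open>y, x\<^sub>i, z\<^sub>k\<close> and \<open>L\<close> for the one on \<open>x, y\<^sub>j, z\<^sub>k\<close>. The
  minimal resolution of \<open>Q/I\<close> is supported on two simplices that share one vertex, the edge \<open>xy\<close>,
  and it embeds into \<open>K \<times> L\<close>: the basis element of \<open>xs\<close> goes to \<open>(x e\<^sub>s, s e\<^sub>x)\<close>, that of \<open>yt\<close> to
  \<open>(t e\<^sub>y, y e\<^sub>t)\<close>, so that both rules send that of \<open>xy\<close> to \<open>(x e\<^sub>y, y e\<^sub>x)\<close>, and the image in
  degrees \<open>n \<ge> 2\<close> is \<open>x K\<^sub>n \<times> y L\<^sub>n\<close>. This image is closed under the product: in positive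
  degrees all coefficients in \<open>K\<close> are divisible by \<open>x\<close> except those of \<open>e\<^sub>y\<close>, and \<open>e\<^sub>y e\<^sub>y = 0\<close>;
  likewise for \<open>L\<close>. Hence the laws of a dg algebra are inherited from \<open>K \<times> L\<close>, and so is
  exactness, since a cycle of degree 1 is divisible by \<open>x\<close> in \<open>K\<close> and by \<open>y\<close> in \<open>L\<close>.
\<close>

section \<open>The exterior algebra\<close>

text \<open>The guard excludes the junk value 1 of products over infinite sets.\<close>

definition shuffle_sign :: "'v::linorder set \<Rightarrow> 'v set \<Rightarrow> 'r::comm_ring_1" where
  "shuffle_sign A B = (if finite A \<and> finite B
     then \<Prod>i\<in>A. \<Prod>j\<in>B. if i < j then 1 else if j < i then - 1 else 0
     else 0)"

lemma shuffle_sign_infinite [simp]: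
  "infinite A \<Longrightarrow> shuffle_sign A B = 0" "infinite B \<Longrightarrow> shuffle_sign A B = 0"
  by (simp_all add: shuffle_sign_def)

lemma shuffle_sign_empty [simp]:
  "finite B \<Longrightarrow> shuffle_sign {} B = 1" "finite A \<Longrightarrow> shuffle_sign A {} = 1"
  by (simp_all add: shuffle_sign_def)

lemma shuffle_sign_overlap:
  assumes "A \<inter> B \<noteq> {}"
  shows "shuffle_sign A B = (0 :: 'r::comm_ring_1)"
proof (cases "finite A \<and> finite B")
  case True
  obtain i where i: "i \<in> A" "i \<in> B" using assms by blast
  with True have "(\<Prod>j\<in>B. if i < j then 1 else if j < i then - 1 else 0) = (0 :: 'r)"
    by (intro prod_zero) auto
  with True i(1) show ?thesis
    unfolding shuffle_sign_def by (auto intro!: prod_zero bexI[of _ i])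
qed auto

lemma shuffle_sign_Un_left:
  "A \<inter> B = {} \<Longrightarrow> shuffle_sign (A \<union> B) C = shuffle_sign A C * shuffle_sign B C"
  by (simp add: shuffle_sign_def prod.union_disjoint)

lemma shuffle_sign_Un_right:
  "B \<inter> C = {} \<Longrightarrow> shuffle_sign A (B \<union> C) = shuffle_sign A B * shuffle_sign A C"
  by (simp add: shuffle_sign_def prod.union_disjoint prod.distrib)

lemma shuffle_sign_insert_right:
  "i \<notin> B \<Longrightarrow> shuffle_sign A (insert i B) = shuffle_sign A {i} * shuffle_sign A B"
  using shuffle_sign_Un_right[of "{i}" B A] by simp

lemma shuffle_sign_assoc:
  "shuffle_sign A B * shuffle_sign (A \<union> B) C = shuffle_sign A (B \<union> C) * shuffle_sign B C"
proof -
  consider "A \<inter> B \<noteq> {}" | "B \<inter> C \<noteq> {}" | "A \<inter> B = {}" "B \<inter> C = {}"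
    by blast
  then show ?thesis
  proof cases
    case 1
    then show ?thesis by (simp add: shuffle_sign_overlap Int_Un_distrib)
  next
    case 2
    then show ?thesis by (simp add: shuffle_sign_overlap Int_Un_distrib2)
  qed (simp add: shuffle_sign_Un_left shuffle_sign_Un_right ac_simps)
qed

lemma shuffle_sign_commute:
  "shuffle_sign A B = (- 1) ^ (card A * card B) * (shuffle_sign B A :: 'r::comm_ring_1)"
proof (cases "finite A \<and> finite B")
  case True
  then have "shuffle_sign B A = (\<Prod>i\<in>A. \<Prod>j\<in>B. if j < i then 1 else if i < j then - 1 else 0 :: 'r)"
    unfolding shuffle_sign_def by (simp add: prod.swap[of _ A B])
  then have "(- 1) ^ (card A * card B) * (shuffle_sign B A :: 'r)
      = (\<Prod>i\<in>A. \<Prod>j\<in>B. - 1 * (if j < i then 1 else if i < j then - 1 else 0 :: 'r))"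
    by (simp only: prod.distrib prod_constant mult.commute[of "card A"] power_mult)
  also have "\<dots> = shuffle_sign A B"
    using True unfolding shuffle_sign_def by (auto intro!: prod.cong)
  finally show ?thesis ..
qed auto

lemma shuffle_sign_square:
  assumes "finite A" "finite B" "A \<inter> B = {}"
  shows "shuffle_sign A B * shuffle_sign A B = (1 :: 'r::comm_ring_1)"
proof -
  have "shuffle_sign A B * (shuffle_sign A B :: 'r)
      = (\<Prod>i\<in>A. \<Prod>j\<in>B. (if i < j then 1 else if j < i then - 1 else 0) *
          (if i < j then 1 else if j < i then - 1 else 0 :: 'r))"
    using assms by (simp only: shuffle_sign_def prod.distrib simp_thms if_True)
  also have "\<dots> = 1"
    using assms(3) by (intro prod.neutral ballI) (auto simp: not_less_iff_gr_or_eq)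
  finally show ?thesis .
qed

lemma shuffle_sign_square_left:
  "finite A \<Longrightarrow> finite B \<Longrightarrow> A \<inter> B = {} \<Longrightarrow> shuffle_sign A B * (shuffle_sign A B * x) = x"
  by (simp add: shuffle_sign_square flip: mult.assoc)

lemma shuffle_sign_less:
  "finite B \<Longrightarrow> (\<And>j. j \<in> B \<Longrightarrow> i < j) \<Longrightarrow> shuffle_sign {i} B = 1"
  by (auto simp: shuffle_sign_def intro!: prod.neutral)

lemma shuffle_sign_remove_less:
  assumes "finite U" "j \<in> U" "i \<notin> U" "j < i"
  shows "shuffle_sign {i} U = - (shuffle_sign {i} (U - {j}) :: 'r::comm_ring_1)"
proof -
  have "shuffle_sign {i} {j} = (- 1 :: 'r)"
    using assms(4) by (auto simp: shuffle_sign_def)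
  then show ?thesis
    using shuffle_sign_insert_right[of j "U - {j}" "{i}", where 'b = 'r] assms(2)
    by (simp add: insert_absorb)
qed

text \<open>A function \<open>u\<close> on sets stands for the element \<open>\<Sum>\<^bsub>S\<^esub> u S \<cdot> e\<^bsub>S\<^esub>\<close> of the exterior algebra on
  generators \<open>e\<^sub>i\<close>, where \<open>e\<^bsub>S\<^esub>\<close> is the product of the \<open>e\<^sub>i\<close> with \<open>i \<in> S\<close> in increasing order.\<close>

definition face :: "'v set \<Rightarrow> 'v set \<Rightarrow> 'r::comm_ring_1" where
  "face S T = (if T = S then 1 else 0)"

definition wedge ::
  "('v::linorder set \<Rightarrow> 'r::comm_ring_1) \<Rightarrow> ('v set \<Rightarrow> 'r) \<Rightarrow> 'v set \<Rightarrow> 'r" where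
  "wedge u v U = (\<Sum>(S, T)\<in>{(S, T). S \<union> T = U}. shuffle_sign S T * u S * v T)"

definition ext_power :: "'v set \<Rightarrow> nat \<Rightarrow> ('v set \<Rightarrow> 'r::zero) set" where
  "ext_power N n = {u. \<forall>S. u S \<noteq> 0 \<longrightarrow> S \<subseteq> N \<and> card S = n}"

lemma ext_power_eq_0: "u \<in> ext_power N n \<Longrightarrow> \<not> (S \<subseteq> N \<and> card S = n) \<Longrightarrow> u S = 0"
  by (auto simp: ext_power_def)

lemma face_in_ext_power: "S \<subseteq> N \<Longrightarrow> card S = n \<Longrightarrow> face S \<in> ext_power N n"
  by (simp add: ext_power_def face_def)

lemma ext_power_scale: "u \<in> ext_power N n \<Longrightarrow> (\<lambda>S. c * u S) \<in> ext_power N n"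
  for u :: "_ \<Rightarrow> 'r::comm_ring_1"
  unfolding ext_power_def by (blast dest: mult_not_zero)

lemma ext_power_face_expansion:
  assumes "finite N" "u \<in> ext_power N n"
  shows "u = (\<lambda>T. \<Sum>S\<in>Pow N. u S * face S T)"
proof
  fix T
  have "(\<Sum>S\<in>Pow N. u S * face S T) = (\<Sum>S\<in>Pow N. if S = T then u T else 0)"
    by (rule sum.cong) (auto simp: face_def)
  then show "u T = (\<Sum>S\<in>Pow N. u S * face S T)"
    using assms ext_power_eq_0[OF assms(2), of T] by auto
qed

lemma finite_set_pairs_Un: "finite U \<Longrightarrow> finite {(S, T). S \<union> T = U}"
  by (rule finite_subset[of _ "Pow U \<times> Pow U"]) auto

lemma wedge_infinite:
  assumes "infinite U"
  shows "wedge u v U = (0 :: 'r::comm_ring_1)"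
proof -
  have "shuffle_sign S T = (0 :: 'r)" if "S \<union> T = U" for S T
    using assms that by (metis finite_UnI shuffle_sign_infinite)
  then show ?thesis by (auto simp: wedge_def intro!: sum.neutral)
qed

lemma wedge_zero_left: "wedge (\<lambda>_. 0) v U = 0"
  by (simp add: wedge_def case_prod_unfold)

lemma wedge_zero_right: "wedge u (\<lambda>_. 0) U = 0"
  by (simp add: wedge_def case_prod_unfold)

lemma wedge_sum_left: "wedge (\<lambda>S. \<Sum>i\<in>I. c i * u i S) v U = (\<Sum>i\<in>I. c i * wedge (u i) v U)"
  unfolding wedge_def case_prod_unfold sum_distrib_left sum_distrib_right
  by (subst sum.swap) (simp add: ac_simps)

lemma wedge_sum_right: "wedge u (\<lambda>S. \<Sum>i\<in>I. c i * v i S) U = (\<Sum>i\<in>I. c i * wedge u (v i) U)"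
  unfolding wedge_def case_prod_unfold sum_distrib_left sum_distrib_right
  by (subst sum.swap) (simp add: ac_simps)

lemma wedge_scale_left: "wedge (\<lambda>S. c * u S) v U = c * wedge u v U"
  using wedge_sum_left[of "\<lambda>_. c" "\<lambda>_. u" "{()}"] by simp

lemma wedge_scale_right: "wedge u (\<lambda>S. c * v S) U = c * wedge u v U"
  using wedge_sum_right[of u "\<lambda>_. c" "\<lambda>_. v" "{()}"] by simp

lemma wedge_add_right: "wedge u (\<lambda>S. v S + w S) U = wedge u v U + wedge u w U"
  by (simp add: wedge_def algebra_simps sum.distrib case_prod_beta)

lemma wedge_diff_left: "wedge (\<lambda>S. u S - v S) w U = wedge u w U - wedge v w U"
  by (simp add: wedge_def algebra_simps sum_subtractf case_prod_beta)

lemma wedge_face_left: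
  fixes v :: "'v::linorder set \<Rightarrow> 'r::comm_ring_1"
  shows "wedge (face S) v U = (if S \<subseteq> U then shuffle_sign S (U - S) * v (U - S) else 0)"
proof (cases "finite U")
  case True
  have summand: "(case P of (S', T) \<Rightarrow> shuffle_sign S' T * face S S' * v T)
      = (if P = (S, U - S) then shuffle_sign S (U - S) * v (U - S) else 0)"
    if "P \<in> {(S', T). S' \<union> T = U}" for P
  proof -
    obtain S' T where P: "P = (S', T)" by (cases P)
    show ?thesis
    proof (cases "S' = S \<and> S \<inter> T = {}")
      case True
      then have "T = U - S" using that by (auto simp: P)
      with True show ?thesis by (simp add: P face_def)
    next
      case False
      then have "face S S' = (0 :: 'r) \<or> shuffle_sign S' T = (0 :: 'r)"
        by (auto simp: face_def shuffle_sign_overlap)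
      moreover have "P \<noteq> (S, U - S)" using False by (auto simp: P)
      ultimately show ?thesis by (auto simp: P)
    qed
  qed
  have "wedge (face S) v U = (\<Sum>P\<in>{(S', T). S' \<union> T = U}.
      if P = (S, U - S) then shuffle_sign S (U - S) * v (U - S) else 0)"
    unfolding wedge_def by (rule sum.cong[OF refl summand])
  then show ?thesis
    using finite_set_pairs_Un[OF True] by auto
next
  case False
  then have "shuffle_sign S (U - S) = (0 :: 'r)" by (cases "finite S") auto
  with False show ?thesis by (simp add: wedge_infinite)
qed

lemma wedge_assoc: "wedge (wedge u v) w = wedge u (wedge v w)"
proof
  fix U
  show "wedge (wedge u v) w U = wedge u (wedge v w) U"
  proof (cases "finite U")
    case True
    have fin: "finite {P. fst P \<union> snd P = A}" if "A \<subseteq> U" for A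
      using finite_set_pairs_Un[OF finite_subset[OF that True]] by (simp add: case_prod_unfold)
    have "wedge (wedge u v) w U = (\<Sum>P | fst P \<union> snd P = U. \<Sum>Q | fst Q \<union> snd Q = fst P.
        shuffle_sign (fst Q) (snd Q) * shuffle_sign (fst P) (snd P) *
        (u (fst Q) * v (snd Q) * w (snd P)))"
      by (simp add: wedge_def case_prod_unfold sum_distrib_left sum_distrib_right ac_simps)
    also have "\<dots> = (\<Sum>(P, Q)\<in>(SIGMA P:{P. fst P \<union> snd P = U}. {Q. fst Q \<union> snd Q = fst P}).
        shuffle_sign (fst Q) (snd Q) * shuffle_sign (fst P) (snd P) *
        (u (fst Q) * v (snd Q) * w (snd P)))"
      by (rule sum.Sigma) (intro ballI fin; force)+
    also have "\<dots> = (\<Sum>(P, Q)\<in>(SIGMA P:{P. fst P \<union> snd P = U}. {Q. fst Q \<union> snd Q = snd P}).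
        shuffle_sign (fst P) (snd P) * shuffle_sign (fst Q) (snd Q) *
        (u (fst P) * v (fst Q) * w (snd Q)))"
      by (rule sum.reindex_bij_witness[where i = "\<lambda>((R, B), S, T). ((R \<union> S, T), R, S)"
            and j = "\<lambda>((A, T), R, S). ((R, S \<union> T), S, T)"])
         (clarsimp simp: shuffle_sign_assoc Un_assoc)+
    also have "\<dots> = (\<Sum>P | fst P \<union> snd P = U. \<Sum>Q | fst Q \<union> snd Q = snd P.
        shuffle_sign (fst P) (snd P) * shuffle_sign (fst Q) (snd Q) *
        (u (fst P) * v (fst Q) * w (snd Q)))"
      by (rule sum.Sigma[symmetric]) (intro ballI fin; force)+
    also have "\<dots> = wedge u (wedge v w) U"
      by (simp add: wedge_def case_prod_unfold sum_distrib_left ac_simps)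
    finally show ?thesis .
  qed (simp add: wedge_infinite)
qed

lemma wedge_nonzeroE:
  assumes "wedge u v U \<noteq> 0"
  obtains S T where "S \<union> T = U" "shuffle_sign S T * u S * v T \<noteq> 0"
proof -
  obtain P where "P \<in> {(S, T). S \<union> T = U}" "(case P of (S, T) \<Rightarrow> shuffle_sign S T * u S * v T) \<noteq> 0"
    using assms unfolding wedge_def by (rule sum.not_neutral_contains_not_neutral)
  then show ?thesis using that[of "fst P" "snd P"] by (simp add: case_prod_unfold)
qed

lemma wedge_in_ext_power:
  fixes u v :: "'v::linorder set \<Rightarrow> 'r::comm_ring_1"
  assumes "finite N" "u \<in> ext_power N m" "v \<in> ext_power N n"
  shows "wedge u v \<in> ext_power N (m + n)"
  unfolding ext_power_def
proof (intro CollectI allI impI)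
  fix U assume "wedge u v U \<noteq> 0"
  then obtain S T where ST: "S \<union> T = U" "shuffle_sign S T * u S * v T \<noteq> 0" by (rule wedge_nonzeroE)
  then have "u S \<noteq> 0" "v T \<noteq> 0" by auto
  with assms have "S \<subseteq> N" "card S = m" "T \<subseteq> N" "card T = n"
    by (auto simp: ext_power_def)
  moreover have "S \<inter> T = {}"
    using ST(2) shuffle_sign_overlap[of S T, where 'r = 'r] by (cases "S \<inter> T = {}") auto
  moreover have "finite S" "finite T"
    using assms(1) \<open>S \<subseteq> N\<close> \<open>T \<subseteq> N\<close> by (auto intro: finite_subset)
  ultimately show "U \<subseteq> N \<and> card U = m + n"
    using ST(1) card_Un_disjoint[of S T] by auto
qed

lemma wedge_commute:
  assumes "u \<in> ext_power N m" "v \<in> ext_power N n"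
  shows "wedge u v U = (- 1) ^ (m * n) * wedge v u U"
proof -
  have sign: "shuffle_sign S T * u S * v T = (- 1) ^ (m * n) * (shuffle_sign T S * v T * u S)"
    for S T
  proof (cases "u S = 0 \<or> v T = 0")
    case False
    then have "card S = m" "card T = n" using assms by (auto simp: ext_power_def)
    then show ?thesis by (simp add: shuffle_sign_commute[of S T] ac_simps)
  qed auto
  have "wedge u v U = (\<Sum>(T, S)\<in>{(T, S). T \<union> S = U}. shuffle_sign S T * u S * v T)"
    unfolding wedge_def by (rule sum.reindex_bij_witness[where i = prod.swap and j = prod.swap]) auto
  also have "\<dots> = (- 1) ^ (m * n) * wedge v u U"
    by (simp add: sign wedge_def sum_distrib_left case_prod_beta)
  finally show ?thesis .
qed

lemma wedge_one_left:
  assumes "finite N" "v \<in> ext_power N n"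
  shows "wedge (face {}) v = v"
proof
  fix U
  have "v U = 0" if "infinite U"
    using ext_power_eq_0[OF assms(2)] assms(1) finite_subset that by metis
  then show "wedge (face {}) v U = v U" by (cases "finite U") (simp_all add: wedge_face_left)
qed

lemma wedge_one_right:
  assumes "finite N" "v \<in> ext_power N n"
  shows "wedge v (face {}) = v"
proof
  fix U
  show "wedge v (face {}) U = v U"
    using wedge_commute[OF assms(2) face_in_ext_power[of "{}" N 0], of U] wedge_one_left[OF assms]
    by simp
qed

lemma dvd_wedge:
  assumes "\<And>S. S \<noteq> {h} \<Longrightarrow> x dvd u S" "\<And>S. S \<noteq> {h} \<Longrightarrow> x dvd v S"
  shows "x dvd wedge u v U"
  unfolding wedge_def
proof (rule dvd_sum, clarify)
  fix S T
  consider "S \<noteq> {h}" | "T \<noteq> {h}" | "S = {h}" "T = {h}" by blast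
  then show "x dvd shuffle_sign S T * u S * v T"
    by cases (simp_all add: assms shuffle_sign_overlap)
qed

lemma sum_antisymmetric:
  fixes f :: "'i \<Rightarrow> 'i \<Rightarrow> 'r::ab_group_add"
  assumes "finite N" "\<And>i j. i \<in> N \<Longrightarrow> j \<in> N \<Longrightarrow> f i j = - f j i" "\<And>i. i \<in> N \<Longrightarrow> f i i = 0"
  shows "(\<Sum>i\<in>N. \<Sum>j\<in>N. f i j) = 0"
  using assms
proof (induction N rule: finite_induct)
  case (insert k N)
  have "(\<Sum>i\<in>N. f i k) = (\<Sum>i\<in>N. - f k i)"
    using insert.prems(1) by (intro sum.cong) (blast, blast)
  moreover have "(\<Sum>i\<in>N. \<Sum>j\<in>N. f i j) = 0"
    by (rule insert.IH) (use insert.prems in blast)+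
  moreover have "f k k = 0" using insert.prems(2) by blast
  ultimately show ?case using insert.hyps by (simp add: sum.distrib sum_negf)
qed simp

lemma wedge_self_odd:
  assumes "u \<in> ext_power N n" "odd n"
  shows "wedge u u U = 0"
proof (cases "finite U")
  case True
  let ?f = "\<lambda>S T. if S \<union> T = U then shuffle_sign S T * u S * u T else 0"
  have "wedge u u U = (\<Sum>(S, T)\<in>Pow U \<times> Pow U. ?f S T)"
    unfolding wedge_def using True
    by (intro sum.mono_neutral_cong_left) (auto split: if_splits)
  also have "\<dots> = (\<Sum>S\<in>Pow U. \<Sum>T\<in>Pow U. ?f S T)"
    by (rule sum.cartesian_product[symmetric])
  also have "\<dots> = 0"
  proof (rule sum_antisymmetric)
    show "?f S T = - ?f T S" for S T
    proof (cases "u S = 0 \<or> u T = 0")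
      case False
      then have "card S = n" "card T = n" using assms(1) by (auto simp: ext_power_def)
      then show ?thesis using assms(2) by (auto simp: shuffle_sign_commute[of S T] Un_commute)
    qed auto
    show "?f S S = 0" for S
    proof (cases "S = {}")
      case True
      then show ?thesis using odd_pos[OF assms(2)] ext_power_eq_0[OF assms(1), of "{}"] by simp
    qed (auto simp: shuffle_sign_overlap)
  qed (use True in simp)
  finally show ?thesis .
qed (simp add: wedge_infinite)

section \<open>The Koszul differential\<close>

definition contract :: "'v::linorder \<Rightarrow> ('v set \<Rightarrow> 'r::comm_ring_1) \<Rightarrow> 'v set \<Rightarrow> 'r" where
  "contract i u U = shuffle_sign {i} U * u (insert i U)"

definition koszul_diff ::
  "'v::linorder set \<Rightarrow> ('v \<Rightarrow> 'r::comm_ring_1) \<Rightarrow> ('v set \<Rightarrow> 'r) \<Rightarrow> 'v set \<Rightarrow> 'r" where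
  "koszul_diff N X u U = (\<Sum>i\<in>N. X i * contract i u U)"

lemma contract_sum: "contract j (\<lambda>S. \<Sum>i\<in>I. c i * u i S) U = (\<Sum>i\<in>I. c i * contract j (u i) U)"
  by (simp add: contract_def sum_distrib_left ac_simps)

lemma contract_scale: "contract i (\<lambda>S. c * u S) U = c * contract i u U"
  by (simp add: contract_def ac_simps)

lemma contract_anticommute: "contract i (contract j u) U = - contract j (contract i u) U"
  for u :: "'v::linorder set \<Rightarrow> 'r::comm_ring_1"
proof (cases "i \<noteq> j \<and> i \<notin> U \<and> j \<notin> U")
  case True
  then have "shuffle_sign {i} {j} = - (shuffle_sign {j} {i} :: 'r)"
    by (simp add: shuffle_sign_commute[of "{i}" "{j}"])
  with True show ?thesis
    by (simp add: contract_def shuffle_sign_insert_right[of _ U] insert_commute ac_simps)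
qed (auto simp: contract_def shuffle_sign_overlap)

lemma contract_twice: "contract i (contract i u) U = 0"
  by (simp add: contract_def shuffle_sign_overlap)

lemma koszul_diff_koszul_diff:
  assumes "finite N"
  shows "koszul_diff N X (koszul_diff N X u) U = 0"
proof -
  have "koszul_diff N X (koszul_diff N X u) U
      = (\<Sum>i\<in>N. \<Sum>j\<in>N. X i * (X j * contract i (contract j u) U))"
    unfolding koszul_diff_def[abs_def] by (simp add: contract_sum sum_distrib_left)
  also have "\<dots> = 0"
  proof (rule sum_antisymmetric[OF assms])
    show "X i * (X j * contract i (contract j u) U) = - (X j * (X i * contract j (contract i u) U))"
      for i j
      by (simp add: contract_anticommute[of i j] ac_simps)
  qed (simp add: contract_twice)
  finally show ?thesis .
qed

lemma koszul_diff_sum: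
  "koszul_diff N X (\<lambda>S. \<Sum>i\<in>I. c i * u i S) U = (\<Sum>i\<in>I. c i * koszul_diff N X (u i) U)"
  unfolding koszul_diff_def contract_sum sum_distrib_left
  by (subst sum.swap) (simp add: ac_simps)

lemma koszul_diff_scale: "koszul_diff N X (\<lambda>S. c * u S) U = c * koszul_diff N X u U"
  using koszul_diff_sum[of N X "\<lambda>_. c" "\<lambda>_. u" "{()}"] by simp

lemma contract_ext_power:
  assumes "finite N" "u \<in> ext_power N n" "contract i u U \<noteq> 0"
  shows "U \<subseteq> N" "n = Suc (card U)"
proof -
  have "shuffle_sign {i} U \<noteq> (0 :: 'b)" "u (insert i U) \<noteq> 0"
    using assms(3) by (auto simp: contract_def)
  then have "i \<notin> U" "insert i U \<subseteq> N" "card (insert i U) = n"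
    using assms(2) shuffle_sign_overlap[of "{i}" U, where 'r = 'b] by (auto simp: ext_power_def)
  then show "U \<subseteq> N" "n = Suc (card U)"
    using assms(1) finite_subset[of U N] by auto
qed

lemma koszul_diff_in_ext_power:
  assumes "finite N" "u \<in> ext_power N (Suc n)"
  shows "koszul_diff M X u \<in> ext_power N n"
  unfolding ext_power_def
proof (intro CollectI allI impI)
  fix U assume "koszul_diff M X u U \<noteq> 0"
  then obtain i where "X i * contract i u U \<noteq> 0"
    unfolding koszul_diff_def by (rule sum.not_neutral_contains_not_neutral)
  then have "contract i u U \<noteq> 0" by auto
  then show "U \<subseteq> N \<and> card U = n" using contract_ext_power[OF assms, of i U] by simp
qed

lemma koszul_diff_ext_power_0:
  assumes "finite N" "u \<in> ext_power N 0"
  shows "koszul_diff M X u = (\<lambda>_. 0)"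
proof
  fix U
  have "contract i u U = 0" for i using contract_ext_power(2)[OF assms, of i U] by auto
  then show "koszul_diff M X u U = 0" by (simp add: koszul_diff_def)
qed

lemma koszul_diff_gen:
  assumes "finite N" "j \<in> N"
  shows "koszul_diff N X (face {j}) U = X j * face {} U"
proof -
  have "koszul_diff N X (face {j}) U = (\<Sum>i\<in>N. if i = j then X j * face {} U else 0)"
    unfolding koszul_diff_def
    by (rule sum.cong) (auto simp: contract_def face_def shuffle_sign_overlap)
  then show ?thesis using assms by simp
qed

lemma contract_wedge_gen:
  fixes w :: "'v::linorder set \<Rightarrow> 'r::comm_ring_1"
  assumes "\<And>S. infinite S \<Longrightarrow> w S = 0"
  shows "contract i (wedge (face {j}) w) U
    = (if i = j then w U else 0) - wedge (face {j}) (contract i w) U"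
proof (cases "finite U")
  case False
  then show ?thesis
    by (simp add: contract_def wedge_infinite assms)
next
  case True
  consider "i \<in> U" "i = j" | "i \<in> U" "i \<noteq> j" | "i \<notin> U" "i = j" | "i \<notin> U" "i \<noteq> j" "j \<notin> U"
    | "i \<notin> U" "i \<noteq> j" "j \<in> U"
    by blast
  then show ?thesis
  proof cases
    case 5
    define W where "W = U - {j}"
    have W: "U = insert j W" "j \<notin> W" "finite W" and "i \<notin> W"
      using 5 True by (auto simp: W_def)
    have "shuffle_sign {i} {j} * shuffle_sign {j} {i} = (-1 :: 'r)"
      using 5(2) by (simp add: shuffle_sign_commute[of "{i}" "{j}"] shuffle_sign_square)
    then have "shuffle_sign {i} {j} * (shuffle_sign {j} {i} * x) = - x" for x :: 'r
      by (simp flip: mult.assoc)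
    then show ?thesis
      using 5(2) W \<open>i \<notin> W\<close>
      by (simp add: contract_def wedge_face_left shuffle_sign_insert_right[of _ W] insert_Diff_if
          ac_simps)
  qed (use True in \<open>auto simp: contract_def wedge_face_left shuffle_sign_overlap
        shuffle_sign_square_left insert_absorb\<close>)
qed

lemma face_insert:
  assumes "finite A" "i \<notin> A"
  shows "face (insert i A) = (\<lambda>U. shuffle_sign {i} A * wedge (face {i}) (face A) U)"
proof
  fix U
  show "face (insert i A) U = shuffle_sign {i} A * wedge (face {i}) (face A) U"
  proof (cases "i \<in> U \<and> U - {i} = A")
    case True
    then have "U = insert i A" by auto
    with assms show ?thesis by (simp add: wedge_face_left face_def shuffle_sign_square)
  qed (use assms in \<open>auto simp: wedge_face_left face_def\<close>)
qed

lemma contract_wedge_face: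
  fixes v :: "'v::linorder set \<Rightarrow> 'r::comm_ring_1"
  assumes "finite A"
  shows "contract i (wedge (face A) v) U
    = wedge (contract i (face A)) v U + (- 1) ^ card A * wedge (face A) (contract i v) U"
  using assms
proof (induction A arbitrary: U rule: finite_induct)
  case empty
  have "contract i (face {}) = (\<lambda>_. 0 :: 'r)" by (auto simp: contract_def face_def)
  then show ?case by (cases "finite U") (simp_all add: wedge_zero_left wedge_face_left contract_def)
next
  case (insert j A)
  let ?g = "face {j}" and ?a = "face A" and ?s = "shuffle_sign {j} A"
  have face_insert_wedge: "wedge (face (insert j A)) x U = ?s * wedge ?g (wedge ?a x) U" for x U
    unfolding face_insert[OF insert.hyps] wedge_scale_left wedge_assoc ..
  have "contract i (face (insert j A)) S
      = ?s * (if i = j then ?a S else 0) - ?s * wedge ?g (contract i ?a) S" for S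
    unfolding face_insert[OF insert.hyps] contract_scale
    by (subst contract_wedge_gen) (use insert.hyps in \<open>auto simp: face_def right_diff_distrib\<close>)
  then have contract_face: "contract i (face (insert j A))
      = (\<lambda>S. ?s * (if i = j then ?a S else 0) - ?s * wedge ?g (contract i ?a) S)" by blast
  have "wedge (contract i (face (insert j A))) v U
      = ?s * (if i = j then wedge ?a v U else 0) - ?s * wedge ?g (wedge (contract i ?a) v) U"
    unfolding contract_face wedge_diff_left wedge_scale_left wedge_assoc[symmetric]
    by (simp add: wedge_zero_left)
  moreover have "contract i (wedge (face (insert j A)) v) U
      = ?s * ((if i = j then wedge ?a v U else 0) - wedge ?g (contract i (wedge ?a v)) U)"
    unfolding face_insert_wedge contract_scale
    by (subst contract_wedge_gen) (simp_all add: wedge_infinite)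
  moreover have "wedge ?g (contract i (wedge ?a v)) U
      = wedge ?g (wedge (contract i ?a) v) U + (- 1) ^ card A * wedge ?g (wedge ?a (contract i v)) U"
    unfolding insert.IH[abs_def] wedge_add_right wedge_scale_right ..
  ultimately have "contract i (wedge (face (insert j A)) v) U
      = wedge (contract i (face (insert j A))) v U
      - ?s * ((- 1) ^ card A * wedge ?g (wedge ?a (contract i v)) U)"
    by (simp add: right_diff_distrib distrib_left)
  then show ?case
    using insert.hyps by (simp add: face_insert_wedge[of "contract i v"] mult.left_commute)
qed

lemma contract_wedge:
  fixes u v :: "'v::linorder set \<Rightarrow> 'r::comm_ring_1"
  assumes "finite N" "u \<in> ext_power N n"
  shows "contract i (wedge u v) U = wedge (contract i u) v U + (- 1) ^ n * wedge u (contract i v) U"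
proof -
  note expansion = ext_power_face_expansion[OF assms]
  have wedge_u: "wedge u x U = (\<Sum>S\<in>Pow N. u S * wedge (face S) x U)" for x U
    by (subst expansion) (rule wedge_sum_left)
  have contract_u: "contract i u U = (\<Sum>S\<in>Pow N. u S * contract i (face S) U)" for U
    by (subst expansion) (rule contract_sum)
  have "contract i (wedge u v) U = (\<Sum>S\<in>Pow N. u S * contract i (wedge (face S) v) U)"
    unfolding wedge_u[abs_def] contract_sum ..
  also have "\<dots> = (\<Sum>S\<in>Pow N. u S * wedge (contract i (face S)) v U
      + (- 1) ^ n * (u S * wedge (face S) (contract i v) U))"
  proof (rule sum.cong[OF refl])
    fix S assume "S \<in> Pow N"
    then have "finite S" using assms(1) finite_subset by auto
    moreover have "u S = 0 \<or> card S = n" using assms(2) by (auto simp: ext_power_def)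
    ultimately show "u S * contract i (wedge (face S) v) U = u S * wedge (contract i (face S)) v U
        + (- 1) ^ n * (u S * wedge (face S) (contract i v) U)"
      by (auto simp: contract_wedge_face algebra_simps)
  qed
  also have "\<dots> = wedge (contract i u) v U + (- 1) ^ n * wedge u (contract i v) U"
    unfolding wedge_u contract_u[abs_def] wedge_sum_left sum.distrib sum_distrib_left ..
  finally show ?thesis .
qed

lemma koszul_diff_wedge:
  assumes "finite N" "u \<in> ext_power N n"
  shows "koszul_diff M X (wedge u v) U
    = wedge (koszul_diff M X u) v U + (- 1) ^ n * wedge u (koszul_diff M X v) U"
proof -
  have "koszul_diff M X (wedge u v) U
      = (\<Sum>i\<in>M. X i * wedge (contract i u) v U) + (- 1) ^ n * (\<Sum>i\<in>M. X i * wedge u (contract i v) U)"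
    unfolding koszul_diff_def
    by (simp add: contract_wedge[OF assms] distrib_left sum.distrib sum_distrib_left ac_simps)
  then show ?thesis
    unfolding koszul_diff_def[abs_def] by (simp add: wedge_sum_left wedge_sum_right)
qed

section \<open>Variables and divisibility in polynomial rings\<close>

abbreviation lookup where "lookup \<equiv> Poly_Mapping.lookup"
abbreviation keys where "keys \<equiv> Poly_Mapping.keys"
abbreviation single where "single \<equiv> Poly_Mapping.single"

declare One_nat_def [simp del]

definition pvar :: "'v \<Rightarrow> ('v \<Rightarrow>\<^sub>0 nat) \<Rightarrow>\<^sub>0 'k::comm_ring_1" where
  "pvar v = single (single v 1) 1"

definition pdiv :: "'v \<Rightarrow> (('v \<Rightarrow>\<^sub>0 nat) \<Rightarrow>\<^sub>0 'k::comm_ring_1) \<Rightarrow> ('v \<Rightarrow>\<^sub>0 nat) \<Rightarrow>\<^sub>0 'k" where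
  "pdiv v = Poly_Mapping.map_key ((+) (single v 1))"

lemma lookup_pdiv: "lookup (pdiv v p) m = lookup p (single v 1 + m)"
  by (simp add: pdiv_def map_key.rep_eq)

lemma keys_single_add: "keys (single v 1 + m) = insert v (keys m)"
  for m :: "'v \<Rightarrow>\<^sub>0 nat"
  by (auto simp: in_keys_iff lookup_add lookup_single when_def split: if_splits)

lemma single_add_minus_single: "v \<in> keys m \<Longrightarrow> single v 1 + (m - single v 1) = m"
  for m :: "'v \<Rightarrow>\<^sub>0 nat"
  by (intro poly_mapping_eqI) (auto simp: lookup_add lookup_minus lookup_single when_def in_keys_iff)

lemma add_minus_single_assoc: "i \<in> keys m \<Longrightarrow> l + (m - single i 1) = l + m - single i 1"
  for m :: "'v \<Rightarrow>\<^sub>0 nat"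
  by (intro poly_mapping_eqI) (auto simp: lookup_add lookup_minus lookup_single when_def in_keys_iff)

lemma lookup_pvar_mult:
  "lookup (pvar v * p) m = (if v \<in> keys m then lookup p (m - single v 1) else 0)"
proof (cases "v \<in> keys m")
  case True
  have "lookup (pvar v * p) (single v 1 + (m - single v 1)) = lookup p (m - single v 1)"
    by (simp add: lookup_mult pvar_def lookup_single when_mult)
  with True show ?thesis by (simp only: single_add_minus_single if_True)
next
  case False
  then have "m \<noteq> single v 1 + l" for l using keys_single_add[of v l] by auto
  then have "m \<notin> keys (pvar v * p)" using keys_mult[of "pvar v" p] by (auto simp: pvar_def)
  with False show ?thesis by (simp add: in_keys_iff)
qed

lemma pdiv_pvar_mult: "pdiv v (pvar v * p) = p"
  by (intro poly_mapping_eqI) (simp add: lookup_pdiv lookup_pvar_mult keys_single_add)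

lemma pdiv_0 [simp]: "pdiv v 0 = 0"
  using pdiv_pvar_mult[of v 0] by simp

lemma pvar_mult_cancel: "pvar v * p = pvar v * q \<longleftrightarrow> p = q"
  by (metis pdiv_pvar_mult)

lemma pvar_mult_eq_0: "pvar v * p = 0 \<longleftrightarrow> p = 0"
  using pvar_mult_cancel[of v p 0] by simp

lemma pvar_mult_pdiv: "pvar v dvd p \<Longrightarrow> pvar v * pdiv v p = p"
  by (auto simp: dvd_def pdiv_pvar_mult)

lemma pvar_dvd_iff: "pvar v dvd p \<longleftrightarrow> (\<forall>m\<in>keys p. v \<in> keys m)"
proof
  assume "pvar v dvd p"
  then show "\<forall>m\<in>keys p. v \<in> keys m"
    by (auto simp: dvd_def in_keys_iff lookup_pvar_mult split: if_splits)
next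
  assume v: "\<forall>m\<in>keys p. v \<in> keys m"
  have "lookup p m = lookup (pvar v * pdiv v p) m" for m
  proof -
    have "lookup p m = 0" if "v \<notin> keys m" using v that by (meson in_keys_iff)
    then show ?thesis by (simp add: lookup_pvar_mult lookup_pdiv single_add_minus_single)
  qed
  then show "pvar v dvd p" by (metis dvdI poly_mapping_eqI)
qed

lemma pvar_dvd_pvar_mult_iff:
  assumes "v \<noteq> w"
  shows "pvar v dvd pvar w * p \<longleftrightarrow> pvar v dvd p"
proof
  assume dvd: "pvar v dvd pvar w * p"
  have "v \<in> keys m" if "m \<in> keys p" for m
  proof -
    have "single w 1 + m \<in> keys (pvar w * p)"
      using that by (simp add: in_keys_iff lookup_pvar_mult keys_single_add)
    then have "v \<in> keys (single w 1 + m)" using dvd by (simp add: pvar_dvd_iff)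
    then show ?thesis using assms by (simp add: keys_single_add)
  qed
  then show "pvar v dvd p" by (simp add: pvar_dvd_iff)
qed (rule dvd_mult)

lemma single_0_prod:
  "single 0 (prod f I) = (\<Prod>i\<in>I. single 0 (f i) :: ('v \<Rightarrow>\<^sub>0 nat) \<Rightarrow>\<^sub>0 'k::comm_ring_1)"
proof (induction I rule: infinite_finite_induct)
  case (insert i I)
  then show ?case by (simp flip: insert.IH add: mult_single)
qed simp_all

lemma single_0_shuffle_sign:
  "single 0 (shuffle_sign A B) = (shuffle_sign A B :: ('v \<Rightarrow>\<^sub>0 nat) \<Rightarrow>\<^sub>0 'k::comm_ring_1)"
  unfolding shuffle_sign_def by (auto simp: single_0_prod single_uminus intro!: prod.cong)

lemma lookup_single_0_mult: "lookup (single 0 c * p) m = c * lookup p m"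
  by (simp add: mult_map_scale_conv_mult[symmetric] map.rep_eq when_def)

lemma lookup_shuffle_sign_mult: "lookup (shuffle_sign A B * p) m = shuffle_sign A B * lookup p m"
  for p :: "('v \<Rightarrow>\<^sub>0 nat) \<Rightarrow>\<^sub>0 'k::comm_ring_1"
  by (simp only: lookup_single_0_mult flip: single_0_shuffle_sign)

section \<open>Exactness of the Koszul complex on a set of variables\<close>

definition keep_monomials ::
  "('m \<Rightarrow> bool) \<Rightarrow> ('m \<Rightarrow>\<^sub>0 'k::zero) \<Rightarrow> 'm \<Rightarrow>\<^sub>0 'k" where
  "keep_monomials P = Poly_Mapping.mapp (\<lambda>m c. if P m then c else 0)"

lemma lookup_keep_monomials: "lookup (keep_monomials P p) m = (if P m then lookup p m else 0)"
  by (simp add: keep_monomials_def lookup_mapp when_def in_keys_iff)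

text \<open>The Koszul complex is graded by monomials, \<open>x\<^sup>m e\<^bsub>U\<^esub>\<close> having degree \<open>x\<^sup>m \<cdot> \<Prod>\<^bsub>i \<in> U\<^esub> x\<^sub>i\<close>. Its
  strand in a given degree is the augmented chain complex of a simplex, whose vertices are the
  variables in \<open>N\<close> that divide the degree. The map \<open>koszul_cone\<close> takes the cone of a face with the
  least vertex \<open>j\<close> of this simplex, \<open>x\<^sup>m e\<^bsub>U\<^esub> \<mapsto> (x\<^sup>m / x\<^sub>j) e\<^sub>j e\<^bsub>U\<^esub>\<close>.\<close>

definition koszul_cone ::
  "'v::linorder set \<Rightarrow> ('v set \<Rightarrow> ('v \<Rightarrow>\<^sub>0 nat) \<Rightarrow>\<^sub>0 'k::comm_ring_1) \<Rightarrow> 'v set \<Rightarrow> ('v \<Rightarrow>\<^sub>0 nat) \<Rightarrow>\<^sub>0 'k"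
where
  "koszul_cone N u U = (if U \<noteq> {} \<and> U \<subseteq> N
     then keep_monomials (\<lambda>m. \<forall>i\<in>N. i < Min U \<longrightarrow> i \<notin> keys m) (pdiv (Min U) (u (U - {Min U})))
     else 0)"

lemma koszul_cone_in_ext_power:
  assumes "finite N" "u \<in> ext_power N n"
  shows "koszul_cone N u \<in> ext_power N (Suc n)"
  unfolding ext_power_def
proof (intro CollectI allI impI)
  fix U assume nonzero: "koszul_cone N u U \<noteq> 0"
  then have U: "U \<noteq> {}" "U \<subseteq> N" by (auto simp: koszul_cone_def split: if_splits)
  then have "finite U" using assms(1) finite_subset by auto
  have "u (U - {Min U}) \<noteq> 0"
  proof
    assume "u (U - {Min U}) = 0"
    then have "koszul_cone N u U = 0"
      by (intro poly_mapping_eqI) (simp add: koszul_cone_def lookup_keep_monomials lookup_pdiv)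
    with nonzero show False by simp
  qed
  then have "card (U - {Min U}) = n" using assms(2) by (auto simp: ext_power_def)
  moreover have "Min U \<in> U" using U \<open>finite U\<close> by simp
  ultimately show "U \<subseteq> N \<and> card U = Suc n"
    using U(2) card_Suc_Diff1[OF \<open>finite U\<close>] by metis
qed

definition least_vertex :: "'v::linorder set \<Rightarrow> 'v set \<Rightarrow> ('v \<Rightarrow>\<^sub>0 nat) \<Rightarrow> 'v \<Rightarrow> bool" where
  "least_vertex N U m j \<longleftrightarrow> j \<in> N \<inter> (U \<union> keys m) \<and> (\<forall>i\<in>N \<inter> (U \<union> keys m). j \<le> i)"

lemma least_vertex_exists:
  assumes "finite N" "N \<inter> (U \<union> keys m) \<noteq> {}"
  obtains j where "least_vertex N U m j"
proof
  show "least_vertex N U m (Min (N \<inter> (U \<union> keys m)))"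
    unfolding least_vertex_def using assms by (meson Min_in Min_le finite_Int)
qed

lemma least_vertex_insert:
  assumes "least_vertex N U m j" "i \<in> keys m"
  shows "least_vertex N (insert i U) (m - single i 1) j"
proof -
  have "insert i U \<union> keys (m - single i 1) = U \<union> keys m"
    using keys_single_add[of i "m - single i 1"] single_add_minus_single[OF assms(2)] assms(2)
    by auto
  with assms(1) show ?thesis unfolding least_vertex_def by metis
qed

lemma lookup_koszul_cone:
  assumes "finite N" "U \<subseteq> N" and j: "least_vertex N U m j"
  shows "lookup (koszul_cone N u U) m
    = (if j \<in> U then lookup (u (U - {j})) (single j 1 + m) else 0)"
proof -
  have fin: "finite U" using assms(1,2) finite_subset by auto
  show ?thesis
  proof (cases "j \<in> U")
    case True
    then have "Min U = j" using j assms(2) fin by (intro Min_eqI) (auto simp: least_vertex_def)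
    moreover have "\<forall>i\<in>N. i < j \<longrightarrow> i \<notin> keys m" using j by (force simp: least_vertex_def)
    ultimately show ?thesis
      using True assms(2) by (auto simp: koszul_cone_def lookup_keep_monomials lookup_pdiv)
  next
    case False
    have "j < Min U" if "U \<noteq> {}"
      using Min_in[OF fin that] j assms(2) False by (force simp: least_vertex_def less_le)
    then show ?thesis
      using False j by (auto simp: koszul_cone_def lookup_keep_monomials least_vertex_def)
  qed
qed

lemma lookup_koszul_diff_pvar:
  "lookup (koszul_diff N pvar u U) m
    = (\<Sum>i\<in>N. if i \<in> keys m then shuffle_sign {i} U * lookup (u (insert i U)) (m - single i 1) else 0)"
  unfolding koszul_diff_def contract_def lookup_sum lookup_pvar_mult lookup_shuffle_sign_mult ..

lemma lookup_koszul_diff_koszul_cone: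
  assumes "finite N" "U \<subseteq> N" "least_vertex N U m j"
  shows "lookup (koszul_diff N pvar (koszul_cone N u) U) m
    = (\<Sum>i\<in>N. if i \<in> keys m \<and> j \<in> insert i U
        then shuffle_sign {i} U * lookup (u (insert i U - {j})) (single j 1 + (m - single i 1)) else 0)"
  unfolding lookup_koszul_diff_pvar
proof (rule sum.cong[OF refl])
  fix i assume "i \<in> N"
  then show "(if i \<in> keys m
      then shuffle_sign {i} U * lookup (koszul_cone N u (insert i U)) (m - single i 1) else 0)
    = (if i \<in> keys m \<and> j \<in> insert i U
        then shuffle_sign {i} U * lookup (u (insert i U - {j})) (single j 1 + (m - single i 1)) else 0)"
    using lookup_koszul_cone[OF assms(1) _ least_vertex_insert[OF assms(3)], of i u] assms(2) by auto
qed

lemma koszul_cone_homotopy_notin: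
  fixes u :: "'v::linorder set \<Rightarrow> ('v \<Rightarrow>\<^sub>0 nat) \<Rightarrow>\<^sub>0 'k::comm_ring_1"
  assumes "finite N" "U \<subseteq> N" and j: "least_vertex N U m j" "j \<notin> U"
  shows "lookup (koszul_diff N pvar (koszul_cone N u) U) m
    + lookup (koszul_cone N (koszul_diff N pvar u) U) m = lookup (u U) m"
proof -
  have jm: "j \<in> N" "j \<in> keys m" using j by (auto simp: least_vertex_def)
  have "finite U" "\<And>i. i \<in> U \<Longrightarrow> j < i"
    using assms finite_subset[of U N] by (force simp: least_vertex_def less_le)+
  then have "shuffle_sign {j} U = (1 :: 'k)" by (rule shuffle_sign_less)
  moreover have "lookup (koszul_diff N pvar (koszul_cone N u) U) m
      = (\<Sum>i\<in>N. if i = j then shuffle_sign {j} U * lookup (u U) m else 0)"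
    unfolding lookup_koszul_diff_koszul_cone[OF assms(1,2) j(1)]
    using j(2) jm by (intro sum.cong) (auto simp: single_add_minus_single)
  moreover have "lookup (koszul_cone N (koszul_diff N pvar u) U) m = 0"
    using j(2) by (simp add: lookup_koszul_cone[OF assms(1,2) j(1)])
  ultimately show ?thesis using assms(1) jm(1) by simp
qed

lemma koszul_cone_homotopy_in:
  fixes u :: "'v::linorder set \<Rightarrow> ('v \<Rightarrow>\<^sub>0 nat) \<Rightarrow>\<^sub>0 'k::comm_ring_1"
  assumes "finite N" "U \<subseteq> N" and j: "least_vertex N U m j" "j \<in> U"
  shows "lookup (koszul_diff N pvar (koszul_cone N u) U) m
    + lookup (koszul_cone N (koszul_diff N pvar u) U) m = lookup (u U) m"
proof -
  define W where "W = U - {j}"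
  have W: "U = insert j W" "j \<notin> W" "finite W"
    using j(2) assms(1,2) finite_subset[of U N] by (auto simp: W_def)
  have less: "j < i" if "i \<in> N" "i \<in> W \<or> i \<in> keys m" "i \<noteq> j" for i
    using j(1) that W(1) by (auto simp: least_vertex_def less_le)
  define a where "a i = (if i \<in> keys m
      then shuffle_sign {i} U * lookup (u (insert i U - {j})) (single j 1 + (m - single i 1)) else 0)"
    for i
  define b where "b i = (if i \<in> keys (single j 1 + m)
      then shuffle_sign {i} W * lookup (u (insert i W)) (single j 1 + m - single i 1) else 0)" for i
  have cancel: "a i + b i = (if i = j then lookup (u U) m else 0)" if "i \<in> N" for i
  proof (cases "i = j")
    case True
    have "shuffle_sign {j} W = (1 :: 'k)"
      using W less assms(2) by (intro shuffle_sign_less) auto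
    with True W show ?thesis by (simp add: a_def b_def keys_single_add shuffle_sign_overlap)
  next
    case False
    have "a i + b i = 0" if "i \<in> keys m" "i \<notin> U"
    proof -
      have "shuffle_sign {i} U = - (shuffle_sign {i} W :: 'k)"
        unfolding W_def using W(1,3) j(2) that less[OF \<open>i \<in> N\<close>] False
        by (intro shuffle_sign_remove_less) auto
      moreover have "insert i U - {j} = insert i W" using False W by auto
      ultimately show ?thesis
        using that(1) by (simp add: a_def b_def keys_single_add add_minus_single_assoc)
    qed
    moreover have "a i + b i = 0" if "i \<in> U"
      using that False W by (simp add: a_def b_def shuffle_sign_overlap)
    moreover have "a i + b i = 0" if "i \<notin> keys m"
      using that False by (simp add: a_def b_def keys_single_add)
    ultimately show ?thesis using False by argo
  qed
  have "lookup (koszul_diff N pvar (koszul_cone N u) U) m = sum a N"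
    using j(2) by (simp add: lookup_koszul_diff_koszul_cone[OF assms(1,2) j(1)] a_def)
  moreover have "lookup (koszul_cone N (koszul_diff N pvar u) U) m = sum b N"
    unfolding lookup_koszul_cone[OF assms(1,2) j(1)] lookup_koszul_diff_pvar b_def W_def
    using j(2) by simp
  ultimately show ?thesis
    using cancel assms(1) j(1) by (simp add: sum.distrib[symmetric] least_vertex_def)
qed

theorem koszul_cone_homotopy:
  assumes "finite N" and u: "u \<in> ext_power N (Suc n)"
  shows "koszul_diff N pvar (koszul_cone N u) U + koszul_cone N (koszul_diff N pvar u) U = u U"
proof (cases "U \<subseteq> N")
  case False
  then have "koszul_cone N u (insert i U) = 0" for i by (simp add: koszul_cone_def)
  then show ?thesis
    using False ext_power_eq_0[OF u, of U] by (simp add: koszul_diff_def contract_def koszul_cone_def)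
next
  case True
  show ?thesis
  proof (rule poly_mapping_eqI)
    fix m
    show "lookup (koszul_diff N pvar (koszul_cone N u) U + koszul_cone N (koszul_diff N pvar u) U) m
        = lookup (u U) m"
    proof (cases "N \<inter> (U \<union> keys m) = {}")
      case empty: True
      then have "U = {}" "\<And>i. i \<in> N \<Longrightarrow> i \<notin> keys m" using True by auto
      then show ?thesis
        using ext_power_eq_0[OF u, of "{}"]
        by (simp add: lookup_add lookup_koszul_diff_pvar koszul_cone_def)
    next
      case False
      then obtain j where "least_vertex N U m j" by (rule least_vertex_exists[OF assms(1)])
      then show ?thesis
        using koszul_cone_homotopy_in[OF assms(1) True] koszul_cone_homotopy_notin[OF assms(1) True]
        by (cases "j \<in> U") (simp_all add: lookup_add)
    qed
  qed
qed

corollary koszul_exact: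
  fixes u :: "'v::linorder set \<Rightarrow> ('v \<Rightarrow>\<^sub>0 nat) \<Rightarrow>\<^sub>0 'k::comm_ring_1"
  assumes "finite N" "u \<in> ext_power N (Suc n)" "koszul_diff N pvar u = (\<lambda>_. 0)"
  shows "koszul_diff N pvar (koszul_cone N u) = u"
proof
  fix U
  have "koszul_cone N (koszul_diff N pvar u) U = 0"
    unfolding assms(3)
    by (intro poly_mapping_eqI) (simp add: koszul_cone_def lookup_keep_monomials lookup_pdiv)
  then show "koszul_diff N pvar (koszul_cone N u) U = u U"
    using koszul_cone_homotopy[OF assms(1,2), of U] by simp
qed

section \<open>Coefficients in a polynomial subring and homogeneity\<close>

text \<open>Any linear order on the vertices will do: it only serves to fix signs.\<close>

instance vtx :: countable
  by countable_datatype

instantiation vtx :: linorder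
begin

definition less_eq_vtx :: "vtx \<Rightarrow> vtx \<Rightarrow> bool" where
  "less_eq_vtx v w \<longleftrightarrow> to_nat v \<le> to_nat w"

definition less_vtx :: "vtx \<Rightarrow> vtx \<Rightarrow> bool" where
  "less_vtx v w \<longleftrightarrow> to_nat v < to_nat w"

instance
  by standard (auto simp: less_eq_vtx_def less_vtx_def)

end

lemma polyring_0 [simp, intro]: "0 \<in> polyring V"
  by (simp add: polyring_def)

lemma polyring_single_0 [intro]: "single 0 c \<in> polyring V"
  by (simp add: polyring_def)

lemma polyring_1 [simp, intro]: "(1 :: 'k::comm_ring_1 mpoly) \<in> polyring V"
  by (simp add: polyring_def)

lemma polyring_add [intro]: "p \<in> polyring V \<Longrightarrow> q \<in> polyring V \<Longrightarrow> p + q \<in> polyring V"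
  for p q :: "'k::comm_ring_1 mpoly"
  unfolding polyring_def using Poly_Mapping.keys_add[of p q] by blast

lemma polyring_uminus [intro]: "p \<in> polyring V \<Longrightarrow> - p \<in> polyring V"
  for p :: "'k::comm_ring_1 mpoly"
  by (simp add: polyring_def in_keys_iff)

lemma polyring_mult [intro]:
  fixes p q :: "'k::comm_ring_1 mpoly"
  assumes "p \<in> polyring V" "q \<in> polyring V"
  shows "p * q \<in> polyring V"
  unfolding polyring_def
proof (intro CollectI ballI)
  fix m assume "m \<in> keys (p * q)"
  then obtain k l where "m = k + l" "k \<in> keys p" "l \<in> keys q"
    using keys_mult[of p q] by auto
  then show "keys m \<subseteq> V"
    using assms Poly_Mapping.keys_add[of k l] by (fastforce simp: polyring_def)
qed

lemma polyring_sum [intro]: "(\<And>i. i \<in> I \<Longrightarrow> f i \<in> polyring V) \<Longrightarrow> sum f I \<in> polyring V"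
  for f :: "'i \<Rightarrow> 'k::comm_ring_1 mpoly"
  by (induction I rule: infinite_finite_induct) auto

lemma polyring_shuffle_sign [intro]: "(shuffle_sign A B :: 'k::comm_ring_1 mpoly) \<in> polyring V"
  unfolding single_0_shuffle_sign[symmetric] by (rule polyring_single_0)

lemma polyring_pvar: "v \<in> V \<Longrightarrow> pvar v \<in> polyring V"
  by (simp add: pvar_def polyring_def)

lemma polyring_pdiv [intro]:
  assumes "p \<in> polyring V"
  shows "pdiv v p \<in> polyring V"
  unfolding polyring_def
proof (intro CollectI ballI)
  fix m assume "m \<in> keys (pdiv v p)"
  then have "single v 1 + m \<in> keys p" by (simp add: in_keys_iff lookup_pdiv)
  then have "keys (single v 1 + m) \<subseteq> V" using assms by (simp add: polyring_def)
  then show "keys m \<subseteq> V" by (simp add: keys_single_add)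
qed

lemma polyring_koszul_diff:
  fixes u :: "'v::linorder set \<Rightarrow> 'k::comm_ring_1 mpoly"
  assumes "\<And>S. u S \<in> polyring V" "\<And>i. i \<in> N \<Longrightarrow> X i \<in> polyring V"
  shows "koszul_diff N X u U \<in> polyring V"
  unfolding koszul_diff_def contract_def
  by (intro polyring_sum polyring_mult polyring_shuffle_sign assms)

lemma polyring_koszul_cone:
  assumes "\<And>S. u S \<in> polyring V"
  shows "koszul_cone N u U \<in> polyring V"
proof -
  have "keep_monomials P p \<in> polyring V" if "p \<in> polyring V" for P and p :: "'a mpoly"
    using that keys_mapp_subset[of _ p] by (fastforce simp: polyring_def keep_monomials_def)
  then show ?thesis by (simp add: koszul_cone_def polyring_pdiv assms)
qed

lemma mdeg_add: "mdeg (k + l) = mdeg k + mdeg l"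
proof -
  have "mdeg m = (\<Sum>v\<in>A. lookup m v)" if "finite A" "keys m \<subseteq> A" for m A
    unfolding mdeg_def using that by (intro sum.mono_neutral_left) (auto simp: in_keys_iff)
  note mdeg_eq = this[of "keys k \<union> keys l"]
  show ?thesis
    using Poly_Mapping.keys_add[of k l] by (simp add: mdeg_eq lookup_add sum.distrib)
qed

lemma homogeneous_0 [simp]: "homogeneous t 0"
  by (simp add: homogeneous_def)

lemma homogeneous_sum: "(\<And>i. i \<in> I \<Longrightarrow> homogeneous t (f i)) \<Longrightarrow> homogeneous t (sum f I)"
  for f :: "'i \<Rightarrow> 'k::comm_ring_1 mpoly"
proof (induction I rule: infinite_finite_induct)
  case (insert j I)
  then show ?case
    using Poly_Mapping.keys_add[of "f j" "sum f I"] by (auto simp: homogeneous_def)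
qed auto

lemma homogeneous_mult:
  fixes p q :: "'k::comm_ring_1 mpoly"
  assumes "homogeneous s p" "homogeneous t q"
  shows "homogeneous (s + t) (p * q)"
  unfolding homogeneous_def
proof
  fix m assume "m \<in> keys (p * q)"
  then obtain k l where "m = k + l" "k \<in> keys p" "l \<in> keys q"
    using keys_mult[of p q] by auto
  then show "mdeg m = s + t" using assms by (simp add: homogeneous_def mdeg_add)
qed

lemma homogeneous_shuffle_sign: "homogeneous 0 (shuffle_sign A B :: 'k::comm_ring_1 mpoly)"
  unfolding single_0_shuffle_sign[symmetric] by (simp add: homogeneous_def mdeg_def)

lemma homogeneous_pvar: "homogeneous 1 (pvar v :: 'k::comm_ring_1 mpoly)"
  by (simp add: homogeneous_def pvar_def mdeg_def)

lemma homogeneous_koszul_diff_face: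
  "homogeneous 1 (koszul_diff N pvar (face S) T :: 'k::comm_ring_1 mpoly)"
proof -
  have "homogeneous 0 (contract i (face S) T :: 'k mpoly)" for i
    by (simp add: contract_def face_def homogeneous_shuffle_sign)
  then show ?thesis
    unfolding koszul_diff_def
    using homogeneous_mult[OF homogeneous_pvar] by (intro homogeneous_sum) fastforce
qed

lemma homogeneous_lookup_0: "homogeneous t p \<Longrightarrow> t \<noteq> 0 \<Longrightarrow> lookup p 0 = 0"
  unfolding homogeneous_def
  by (rule ccontr) (auto simp: mdeg_def in_keys_iff[of 0] dest: bspec[of _ _ 0])

section \<open>Complexes embedded in a product of Koszul algebras\<close>

lemma fmodD: "v \<in> fmod V r i \<Longrightarrow> v p \<in> polyring V" "v \<in> fmod V r i \<Longrightarrow> r i \<le> p \<Longrightarrow> v p = 0"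
  by (auto simp: fmod_def)

lemma fmod_add: "v \<in> fmod V r i \<Longrightarrow> w \<in> fmod V r i \<Longrightarrow> (\<lambda>s. v s + w s) \<in> fmod V r i"
  for v w :: "nat \<Rightarrow> 'k::comm_ring_1 mpoly"
  by (auto simp: fmod_def)

lemma fmod_scale: "c \<in> polyring V \<Longrightarrow> v \<in> fmod V r i \<Longrightarrow> (\<lambda>s. c * v s) \<in> fmod V r i"
  for v :: "nat \<Rightarrow> 'k::comm_ring_1 mpoly"
  by (auto simp: fmod_def)

lemma polyring_neg_1_power [intro]: "(- 1) ^ n \<in> (polyring V :: 'k::comm_ring_1 mpoly set)"
  by (cases "even n") auto

lemma mult_zero: "mult r mu i j (\<lambda>_. 0) w = (\<lambda>_. 0)" "mult r mu i j v (\<lambda>_. 0) = (\<lambda>_. 0)"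
  by (simp_all add: mult_def fun_eq_iff)

lemma diff_degree_0: "diff d r 0 v = (\<lambda>_. 0)"
  by (simp add: diff_def)

definition unit_vec :: "nat \<Rightarrow> nat \<Rightarrow> 'r::comm_ring_1" where
  "unit_vec s p = (if p = s then 1 else 0)"

lemma unit_vec_in_fmod: "s < r i \<Longrightarrow> (unit_vec s :: nat \<Rightarrow> 'k::comm_ring_1 mpoly) \<in> fmod V r i"
  by (auto simp: fmod_def unit_vec_def)

definition embed ::
  "(nat \<Rightarrow> nat) \<Rightarrow> (nat \<Rightarrow> nat \<Rightarrow> 'b \<Rightarrow> 'v set \<Rightarrow> 'r::comm_ring_1) \<Rightarrow> nat \<Rightarrow> (nat \<Rightarrow> 'r) \<Rightarrow> 'b \<Rightarrow> 'v set \<Rightarrow> 'r"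
where
  "embed r e i v \<beta> U = (\<Sum>p<r i. v p * e i p \<beta> U)"

lemma embed_zero: "embed r e i (\<lambda>_. 0) \<beta> = (\<lambda>_. 0)"
  by (simp add: embed_def fun_eq_iff)

lemma embed_scale: "embed r e i (\<lambda>p. c * v p) \<beta> U = c * embed r e i v \<beta> U"
  by (simp add: embed_def sum_distrib_left ac_simps)

lemma embed_add: "embed r e i (\<lambda>p. v p + w p) \<beta> U = embed r e i v \<beta> U + embed r e i w \<beta> U"
  by (simp add: embed_def sum.distrib distrib_right)

lemma embed_unit_vec:
  assumes "s < r i"
  shows "embed r e i (unit_vec s) \<beta> = e i s \<beta>"
proof
  fix U
  have "embed r e i (unit_vec s) \<beta> U = (\<Sum>p<r i. if p = s then e i s \<beta> U else 0)"
    unfolding embed_def unit_vec_def by (rule sum.cong) auto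
  then show "embed r e i (unit_vec s) \<beta> U = e i s \<beta> U" using assms by simp
qed

lemma embed_in_ext_power:
  assumes "\<And>p. p < r i \<Longrightarrow> e i p \<beta> \<in> ext_power N n"
  shows "embed r e i v \<beta> \<in> ext_power N n"
  unfolding ext_power_def
proof (intro CollectI allI impI)
  fix S assume "embed r e i v \<beta> S \<noteq> 0"
  then obtain p where "p < r i" "v p * e i p \<beta> S \<noteq> 0"
    unfolding embed_def by (auto elim: sum.not_neutral_contains_not_neutral)
  then have "e i p \<beta> S \<noteq> 0" by auto
  with assms[OF \<open>p < r i\<close>] show "S \<subseteq> N \<and> card S = n" by (auto simp: ext_power_def)
qed

locale embedded_complex =
  fixes V :: "vtx set"
    and r :: "nat \<Rightarrow> nat"
    and d :: "nat \<Rightarrow> nat \<Rightarrow> nat \<Rightarrow> 'k::comm_ring_1 mpoly"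
    and N :: "'b \<Rightarrow> 'v::linorder set"
    and X :: "'b \<Rightarrow> 'v \<Rightarrow> 'k mpoly"
    and e :: "nat \<Rightarrow> nat \<Rightarrow> 'b \<Rightarrow> 'v set \<Rightarrow> 'k mpoly"
  assumes finite_generators: "finite (N \<beta>)"
    and basis_in_ext_power: "p < r i \<Longrightarrow> e i p \<beta> \<in> ext_power (N \<beta>) i"
    and embed_eq_0_imp: "v \<in> fmod V r i \<Longrightarrow> (\<And>\<beta>. embed r e i v \<beta> = (\<lambda>_. 0)) \<Longrightarrow> v = (\<lambda>_. 0)"
    and polyring_d: "d i p q \<in> polyring V"
    and embed_column: "1 \<le> i \<Longrightarrow> q < r i \<Longrightarrow>
      embed r e (i - 1) (\<lambda>p. d i p q) \<beta> = koszul_diff (N \<beta>) (X \<beta>) (e i q \<beta>)"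
begin

abbreviation E :: "nat \<Rightarrow> (nat \<Rightarrow> 'k mpoly) \<Rightarrow> 'b \<Rightarrow> 'v set \<Rightarrow> 'k mpoly" where
  "E \<equiv> embed r e"

lemma E_in_ext_power: "E i v \<beta> \<in> ext_power (N \<beta>) i"
  by (rule embed_in_ext_power) (rule basis_in_ext_power)

lemma E_inject:
  assumes "v \<in> fmod V r i" "w \<in> fmod V r i" "\<And>\<beta> U. E i v \<beta> U = E i w \<beta> U"
  shows "v = w"
proof -
  have "(\<lambda>p. v p + (- 1) * w p) = (\<lambda>_. 0)"
  proof (rule embed_eq_0_imp)
    show "(\<lambda>p. v p + (- 1) * w p) \<in> fmod V r i"
      using assms(1,2) by (intro fmod_add fmod_scale) auto
    show "E i (\<lambda>p. v p + (- 1) * w p) \<beta> = (\<lambda>_. 0)" for \<beta>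
      unfolding fun_eq_iff embed_add embed_scale assms(3) by simp
  qed
  then show ?thesis by (simp add: fun_eq_iff)
qed

lemma diff_in_fmod: "v \<in> fmod V r i \<Longrightarrow> diff d r i v \<in> fmod V r (i - 1)"
  by (auto simp: fmod_def diff_def intro!: polyring_sum polyring_mult polyring_d)

lemma E_diff: "E (i - 1) (diff d r i v) \<beta> = koszul_diff (N \<beta>) (X \<beta>) (E i v \<beta>)"
proof (cases "i = 0")
  case True
  then show ?thesis
    using koszul_diff_ext_power_0[OF finite_generators E_in_ext_power[of 0 v \<beta>], of "N \<beta>" "X \<beta>"]
    by (simp add: diff_degree_0 embed_zero)
next
  case False
  show ?thesis
  proof
    fix U
    have "E (i - 1) (diff d r i v) \<beta> U
        = (\<Sum>p<r (i - 1). \<Sum>q<r i. v q * (d i p q * e (i - 1) p \<beta> U))"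
      using False by (simp add: embed_def diff_def sum_distrib_right sum_distrib_left ac_simps)
    also have "\<dots> = (\<Sum>q<r i. v q * E (i - 1) (\<lambda>p. d i p q) \<beta> U)"
      by (subst sum.swap) (simp add: embed_def sum_distrib_left)
    also have "\<dots> = (\<Sum>q<r i. v q * koszul_diff (N \<beta>) (X \<beta>) (e i q \<beta>) U)"
      using False by (intro sum.cong refl) (simp add: embed_column)
    also have "\<dots> = koszul_diff (N \<beta>) (X \<beta>) (E i v \<beta>) U"
      unfolding embed_def[abs_def] koszul_diff_sum ..
    finally show "E (i - 1) (diff d r i v) \<beta> U = koszul_diff (N \<beta>) (X \<beta>) (E i v \<beta>) U" .
  qed
qed

lemma koszul_diff_E_cycle:
  "diff d r i v = (\<lambda>_. 0) \<Longrightarrow> koszul_diff (N \<beta>) (X \<beta>) (E i v \<beta>) = (\<lambda>_. 0)"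
  using E_diff[of i v \<beta>] by (simp add: embed_zero)

lemma diff_diff:
  assumes "v \<in> fmod V r i"
  shows "diff d r (i - 1) (diff d r i v) = (\<lambda>_. 0)"
proof (rule embed_eq_0_imp)
  show "diff d r (i - 1) (diff d r i v) \<in> fmod V r (i - 1 - 1)"
    by (intro diff_in_fmod assms)
  show "E (i - 1 - 1) (diff d r (i - 1) (diff d r i v)) \<beta> = (\<lambda>_. 0)" for \<beta>
    unfolding E_diff using koszul_diff_koszul_diff[OF finite_generators] by blast
qed

end

locale embedded_dg_algebra = embedded_complex V r d N X e
  for V :: "vtx set" and r and d :: "nat \<Rightarrow> nat \<Rightarrow> nat \<Rightarrow> 'k::comm_ring_1 mpoly"
    and N :: "'b \<Rightarrow> 'v::linorder set" and X and e +
  fixes mu :: "nat \<Rightarrow> nat \<Rightarrow> nat \<Rightarrow> nat \<Rightarrow> nat \<Rightarrow> 'k mpoly"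
  assumes rank_0: "r 0 = 1"
    and basis_0: "e 0 0 \<beta> = face {}"
    and polyring_mu: "mu i j p q s \<in> polyring V"
    and embed_mu: "p < r i \<Longrightarrow> q < r j \<Longrightarrow>
      embed r e (i + j) (mu i j p q) \<beta> = wedge (e i p \<beta>) (e j q \<beta>)"
begin

lemma mult_in_fmod:
  assumes "v \<in> fmod V r i" "w \<in> fmod V r j"
  shows "mult r mu i j v w \<in> fmod V r (i + j)"
  using fmodD(1)[OF assms(1)] fmodD(1)[OF assms(2)] polyring_mu
  by (auto simp: fmod_def mult_def intro!: polyring_sum polyring_mult)

lemma E_mult: "E (i + j) (mult r mu i j v w) \<beta> = wedge (E i v \<beta>) (E j w \<beta>)"
proof
  fix U
  let ?c = "\<lambda>s p q. v p * (w q * (mu i j p q s * e (i + j) s \<beta> U))"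
  have "E (i + j) (mult r mu i j v w) \<beta> U = (\<Sum>s<r (i + j). \<Sum>p<r i. \<Sum>q<r j. ?c s p q)"
    by (simp add: embed_def mult_def sum_distrib_right sum_distrib_left ac_simps)
  also have "\<dots> = (\<Sum>p<r i. \<Sum>q<r j. \<Sum>s<r (i + j). ?c s p q)"
    by (subst sum.swap, subst (2) sum.swap) (rule refl)
  also have "\<dots> = (\<Sum>p<r i. v p * (\<Sum>q<r j. w q * E (i + j) (mu i j p q) \<beta> U))"
    by (simp add: embed_def sum_distrib_left)
  also have "\<dots> = (\<Sum>p<r i. v p * (\<Sum>q<r j. w q * wedge (e i p \<beta>) (e j q \<beta>) U))"
    by (simp add: embed_mu)
  also have "\<dots> = wedge (E i v \<beta>) (E j w \<beta>) U"
    unfolding embed_def[abs_def] wedge_sum_left wedge_sum_right ..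
  finally show "E (i + j) (mult r mu i j v w) \<beta> U = wedge (E i v \<beta>) (E j w \<beta>) U" .
qed

lemma mult_assoc:
  assumes "v \<in> fmod V r i" "w \<in> fmod V r j" "x \<in> fmod V r k"
  shows "mult r mu (i + j) k (mult r mu i j v w) x = mult r mu i (j + k) v (mult r mu j k w x)"
proof (rule E_inject)
  show "mult r mu (i + j) k (mult r mu i j v w) x \<in> fmod V r (i + j + k)"
    by (intro mult_in_fmod assms)
  show "mult r mu i (j + k) v (mult r mu j k w x) \<in> fmod V r (i + j + k)"
    unfolding add.assoc by (intro mult_in_fmod assms)
  show "E (i + j + k) (mult r mu (i + j) k (mult r mu i j v w) x) \<beta> U
      = E (i + j + k) (mult r mu i (j + k) v (mult r mu j k w x)) \<beta> U" for \<beta> U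
    unfolding E_mult wedge_assoc unfolding add.assoc E_mult ..
qed

lemma mult_commute:
  assumes "v \<in> fmod V r i" "w \<in> fmod V r j"
  shows "mult r mu i j v w = (\<lambda>s. (- 1) ^ (i * j) * mult r mu j i w v s)"
proof (rule E_inject[OF mult_in_fmod[OF assms]])
  have wv: "mult r mu j i w v \<in> fmod V r (i + j)"
    unfolding add.commute[of i j] by (intro mult_in_fmod assms)
  then show "(\<lambda>s. (- 1) ^ (i * j) * mult r mu j i w v s) \<in> fmod V r (i + j)"
    by (intro fmod_scale) auto
  have E_wv: "E (i + j) (mult r mu j i w v) \<beta> = wedge (E j w \<beta>) (E i v \<beta>)" for \<beta>
    unfolding add.commute[of i j] by (rule E_mult)
  show "E (i + j) (mult r mu i j v w) \<beta> U
      = E (i + j) (\<lambda>s. (- 1) ^ (i * j) * mult r mu j i w v s) \<beta> U" for \<beta> U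
    unfolding embed_scale E_mult E_wv by (rule wedge_commute[OF E_in_ext_power E_in_ext_power])
qed

lemma mult_self_odd:
  assumes "odd i" "v \<in> fmod V r i"
  shows "mult r mu i i v v = (\<lambda>_. 0)"
proof (rule embed_eq_0_imp[OF mult_in_fmod[OF assms(2,2)]])
  show "E (i + i) (mult r mu i i v v) \<beta> = (\<lambda>_. 0)" for \<beta>
    unfolding E_mult fun_eq_iff using wedge_self_odd[OF E_in_ext_power assms(1)] by blast
qed

lemma unit_in_fmod: "unit_vec 0 \<in> fmod V r 0"
  by (rule unit_vec_in_fmod) (simp add: rank_0)

lemma mult_unit_left:
  assumes "v \<in> fmod V r j"
  shows "mult r mu 0 j (unit_vec 0) v = v"
proof (rule E_inject)
  show "mult r mu 0 j (unit_vec 0) v \<in> fmod V r j"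
    using mult_in_fmod[OF unit_in_fmod assms] by simp
  show "E j (mult r mu 0 j (unit_vec 0) v) \<beta> U = E j v \<beta> U" for \<beta> U
    using E_mult[of 0 j "unit_vec 0" v \<beta>]
    by (simp add: embed_unit_vec rank_0 basis_0 wedge_one_left[OF finite_generators E_in_ext_power])
qed (rule assms)

lemma mult_unit_right:
  assumes "v \<in> fmod V r j"
  shows "mult r mu j 0 v (unit_vec 0) = v"
  using mult_commute[OF assms unit_in_fmod] mult_unit_left[OF assms] by simp

lemma E_mult_diff_left:
  "E (i + j - 1) (mult r mu (i - 1) j (diff d r i v) w) \<beta>
    = wedge (koszul_diff (N \<beta>) (X \<beta>) (E i v \<beta>)) (E j w \<beta>)"
proof (cases "i = 0")
  case True
  have "koszul_diff (N \<beta>) (X \<beta>) (E 0 v \<beta>) = (\<lambda>_. 0)"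
    using E_diff[of 0 v \<beta>] by (simp add: diff_degree_0 embed_zero)
  with True show ?thesis
    by (intro ext) (simp add: diff_degree_0 mult_zero embed_zero wedge_zero_left)
next
  case False
  then have "i + j - 1 = i - 1 + j" by simp
  then show ?thesis by (simp only: E_mult E_diff)
qed

lemma E_mult_diff_right:
  "E (i + j - 1) (mult r mu i (j - 1) v (diff d r j w)) \<beta>
    = wedge (E i v \<beta>) (koszul_diff (N \<beta>) (X \<beta>) (E j w \<beta>))"
proof (cases "j = 0")
  case True
  have "koszul_diff (N \<beta>) (X \<beta>) (E 0 w \<beta>) = (\<lambda>_. 0)"
    using E_diff[of 0 w \<beta>] by (simp add: diff_degree_0 embed_zero)
  with True show ?thesis
    by (intro ext) (simp add: diff_degree_0 mult_zero embed_zero wedge_zero_right)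
next
  case False
  then have "i + j - 1 = i + (j - 1)" by simp
  then show ?thesis by (simp only: E_mult E_diff)
qed

lemma mult_diff_in_fmod:
  assumes "v \<in> fmod V r i" "w \<in> fmod V r j"
  shows "mult r mu (i - 1) j (diff d r i v) w \<in> fmod V r (i + j - 1)"
    and "mult r mu i (j - 1) v (diff d r j w) \<in> fmod V r (i + j - 1)"
proof -
  show "mult r mu (i - 1) j (diff d r i v) w \<in> fmod V r (i + j - 1)"
    using mult_in_fmod[OF diff_in_fmod[OF assms(1)] assms(2)]
    by (cases "i = 0") (simp_all add: diff_degree_0 mult_zero fmod_def)
  show "mult r mu i (j - 1) v (diff d r j w) \<in> fmod V r (i + j - 1)"
    using mult_in_fmod[OF assms(1) diff_in_fmod[OF assms(2)]]
    by (cases "j = 0") (simp_all add: diff_degree_0 mult_zero fmod_def)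
qed

lemma mult_leibniz:
  assumes "v \<in> fmod V r i" "w \<in> fmod V r j"
  shows "diff d r (i + j) (mult r mu i j v w) =
    (\<lambda>s. mult r mu (i - 1) j (diff d r i v) w s + (- 1) ^ i * mult r mu i (j - 1) v (diff d r j w) s)"
proof (rule E_inject[OF diff_in_fmod[OF mult_in_fmod[OF assms]]])
  show "(\<lambda>s. mult r mu (i - 1) j (diff d r i v) w s
      + (- 1) ^ i * mult r mu i (j - 1) v (diff d r j w) s) \<in> fmod V r (i + j - 1)"
    by (intro fmod_add fmod_scale mult_diff_in_fmod[OF assms]) auto
  show "E (i + j - 1) (diff d r (i + j) (mult r mu i j v w)) \<beta> U
      = E (i + j - 1) (\<lambda>s. mult r mu (i - 1) j (diff d r i v) w s
        + (- 1) ^ i * mult r mu i (j - 1) v (diff d r j w) s) \<beta> U" for \<beta> U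
    unfolding embed_add embed_scale E_mult_diff_left E_mult_diff_right E_diff E_mult
    by (rule koszul_diff_wedge[OF finite_generators E_in_ext_power])
qed

theorem dg_algebra_structure: "dg_algebra_structure V r d mu"
  unfolding dg_algebra_structure_def
proof (intro conjI allI ballI impI)
  show "\<exists>u\<in>fmod V r 0. \<forall>j. \<forall>v\<in>fmod V r j. mult r mu 0 j u v = v \<and> mult r mu j 0 v u = v"
    using unit_in_fmod mult_unit_left mult_unit_right by blast
qed (fact polyring_mu mult_assoc mult_commute mult_self_odd mult_leibniz)+

end

section \<open>The resolution of the edge ideal\<close>

locale Lgraph =
  fixes a b c :: nat
begin

abbreviation V :: "vtx set" where
  "V \<equiv> Lverts a b c"

text \<open>Side \<open>False\<close> is that of \<open>K\<close>, side \<open>True\<close> that of \<open>L\<close>.\<close>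

definition hub :: "bool \<Rightarrow> vtx" where
  "hub \<beta> = (if \<beta> then VY else VX)"

definition nbrs :: "bool \<Rightarrow> vtx set" where
  "nbrs \<beta> = insert (hub (\<not> \<beta>)) ((if \<beta> then VYj ` {1..b} else VXi ` {1..a}) \<union> VZk ` {1..c})"

lemma finite_nbrs [simp]: "finite (nbrs \<beta>)"
  by (simp add: nbrs_def)

lemma hub_in_nbrs [simp]: "hub (\<not> \<beta>) \<in> nbrs \<beta>"
  by (simp add: nbrs_def)

lemma hub_eq_iff [simp]: "hub \<beta> = hub \<gamma> \<longleftrightarrow> \<beta> = \<gamma>"
  by (simp add: hub_def)

lemma hub_in_V [simp]: "hub \<beta> \<in> V"
  by (simp add: hub_def Lverts_def)

lemma nbrs_subset_V: "nbrs \<beta> \<subseteq> V"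
  by (auto simp: nbrs_def hub_def Lverts_def)

lemma polyring_pvar_hub [simp, intro]: "pvar (hub \<beta>) \<in> polyring V"
  by (simp add: polyring_pvar)

lemma polyring_pvar_nbr: "s \<in> nbrs \<beta> \<Longrightarrow> pvar s \<in> polyring V"
  using nbrs_subset_V by (intro polyring_pvar) auto

text \<open>The cells are the faces of two simplices with vertex sets \<open>nbrs False\<close> and \<open>nbrs True\<close>, glued
  along the empty face and along the vertices \<open>y\<close> and \<open>x\<close>, which both stand for the edge \<open>xy\<close>.\<close>

definition glue :: "bool \<Rightarrow> vtx set \<Rightarrow> bool \<times> vtx set" where
  "glue \<beta> S = (if S = {} then (False, {})
     else if S = {hub (\<not> \<beta>)} then (False, {hub True})
     else (\<beta>, S))"

definition cells :: "nat \<Rightarrow> (bool \<times> vtx set) set" where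
  "cells i = (\<Union>\<beta>. glue \<beta> ` {S. S \<subseteq> nbrs \<beta> \<and> card S = i})"

definition rank :: "nat \<Rightarrow> nat" where
  "rank i = card (cells i)"

definition cell :: "nat \<Rightarrow> nat \<Rightarrow> bool \<times> vtx set" where
  "cell i = from_nat_into (cells i)"

definition cell_index :: "nat \<Rightarrow> bool \<times> vtx set \<Rightarrow> nat" where
  "cell_index i = to_nat_on (cells i)"

lemma inj_glue: "inj (glue \<beta>)"
  by (auto simp: inj_def glue_def hub_def split: if_splits)

lemma glue_in_cells: "S \<subseteq> nbrs \<beta> \<Longrightarrow> card S = i \<Longrightarrow> glue \<beta> S \<in> cells i"
  by (auto simp: cells_def)

lemma finite_cells: "finite (cells i)"
  by (simp add: cells_def)

lemma cells_subset_nbrs: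
  assumes "(\<beta>, S) \<in> cells i"
  shows "S \<subseteq> nbrs \<beta>" "card S = i"
  using assms hub_in_nbrs[of False] by (auto simp: cells_def glue_def split: if_splits)

lemma cells_0: "cells 0 = {(False, {})}"
proof -
  have "{S. S \<subseteq> nbrs \<beta> \<and> card S = 0} = {{}}" for \<beta>
    using finite_subset[OF _ finite_nbrs] by auto
  then show ?thesis by (simp add: cells_def glue_def)
qed

lemma mem_cells:
  "S \<subseteq> nbrs \<beta> \<Longrightarrow> card S = i \<Longrightarrow> S \<noteq> {} \<Longrightarrow> S \<noteq> {hub (\<not> \<beta>)} \<Longrightarrow> (\<beta>, S) \<in> cells i"
  using glue_in_cells[of S \<beta> i] by (simp add: glue_def)

lemma cells_unglued:
  assumes "(\<beta>, S) \<in> cells i" "1 \<le> i" "(\<beta>, S) \<noteq> (False, {hub True})"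
  shows "S \<noteq> {}" "S \<noteq> {hub (\<not> \<beta>)}"
  using assms by (auto simp: cells_def glue_def split: if_splits)

lemma rank_0: "rank 0 = 1"
  by (simp add: rank_def cells_0)

lemma cell_0: "cell 0 p = (False, {})"
  unfolding cell_def using from_nat_into[of "cells 0" p] by (simp add: cells_0)

lemma bij_betw_cell: "bij_betw (cell i) {..<rank i} (cells i)"
  unfolding cell_def rank_def by (rule bij_betw_from_nat_into_finite[OF finite_cells])

lemma cell_in_cells: "p < rank i \<Longrightarrow> cell i p \<in> cells i"
  using bij_betw_cell by (auto simp: bij_betw_def)

lemma cell_cell_index: "B \<in> cells i \<Longrightarrow> cell i (cell_index i B) = B"
  by (simp add: cell_def cell_index_def countable_finite finite_cells)

lemma cell_index_less: "B \<in> cells i \<Longrightarrow> cell_index i B < rank i"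
  using to_nat_on_finite[OF finite_cells[of i]] by (auto simp: cell_index_def rank_def bij_betw_def)

lemma cell_index_cell: "p < rank i \<Longrightarrow> cell_index i (cell i p) = p"
  using bij_betw_cell[of i] cell_in_cells cell_cell_index cell_index_less
  by (simp add: bij_betw_def inj_on_def)

text \<open>The cell \<open>{s}\<close> on the side of \<open>h\<close> is the edge \<open>hs\<close>; its form is \<open>h e\<^sub>s\<close> on the side of \<open>h\<close> and
  \<open>s e\<^sub>h\<close> on the other side.\<close>

definition cell_form :: "bool \<times> vtx set \<Rightarrow> bool \<Rightarrow> vtx set \<Rightarrow> 'k::comm_ring_1 mpoly" where
  "cell_form = (\<lambda>(\<gamma>, S) \<beta> T.
     if S = {} then face {} T
     else if \<gamma> = \<beta> then pvar (hub \<beta>) * face S T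
     else if card S = 1 then pvar (the_elem S) * face {hub \<gamma>} T
     else 0)"

abbreviation basis_form :: "nat \<Rightarrow> nat \<Rightarrow> bool \<Rightarrow> vtx set \<Rightarrow> 'k::comm_ring_1 mpoly" where
  "basis_form i p \<equiv> cell_form (cell i p)"

abbreviation E :: "nat \<Rightarrow> (nat \<Rightarrow> 'k::comm_ring_1 mpoly) \<Rightarrow> bool \<Rightarrow> vtx set \<Rightarrow> 'k mpoly" where
  "E \<equiv> embed rank basis_form"

lemma cell_form_glue: "cell_form (glue \<beta> S) \<delta> = cell_form (\<beta>, S) \<delta>"
  by (cases \<beta>; cases \<delta>) (auto simp: cell_form_def glue_def hub_def)

lemma cell_form_in_ext_power:
  assumes "B \<in> cells i"
  shows "(cell_form B \<beta> :: _ \<Rightarrow> 'k::comm_ring_1 mpoly) \<in> ext_power (nbrs \<beta>) i"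
proof -
  obtain \<gamma> S where B: "B = (\<gamma>, S)" by fastforce
  then have S: "S \<subseteq> nbrs \<gamma>" "card S = i" using assms cells_subset_nbrs by auto
  have "hub \<gamma> \<in> nbrs \<beta>" if "\<gamma> \<noteq> \<beta>" using that hub_in_nbrs[of \<beta>] by (cases \<gamma>; cases \<beta>) auto
  then show ?thesis
    using S by (auto simp: ext_power_def cell_form_def B face_def)
qed

lemma polyring_cell_form:
  assumes "B \<in> cells i"
  shows "(cell_form B \<beta> T :: 'k::comm_ring_1 mpoly) \<in> polyring V"
proof -
  obtain \<gamma> S where B: "B = (\<gamma>, S)" by fastforce
  then have "S \<subseteq> nbrs \<gamma>" using assms cells_subset_nbrs by auto
  then have "(pvar (the_elem S) :: 'k mpoly) \<in> polyring V" if "card S = 1"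
    using that by (auto simp: polyring_pvar_nbr elim!: card_1_singletonE)
  then show ?thesis by (simp add: cell_form_def B face_def polyring_mult)
qed

lemma basis_form_in_ext_power:
  "p < rank i \<Longrightarrow> (basis_form i p \<beta> :: _ \<Rightarrow> 'k::comm_ring_1 mpoly) \<in> ext_power (nbrs \<beta>) i"
  by (rule cell_form_in_ext_power[OF cell_in_cells])

lemma basis_form_0: "basis_form 0 p \<beta> = face {}"
  by (simp add: cell_0 cell_form_def fun_eq_iff)

lemma pvar_hub_dvd_cell_form:
  assumes "B \<in> cells i" "1 \<le> i" "T \<noteq> {hub (\<not> \<beta>)}"
  shows "pvar (hub \<beta>) dvd cell_form B \<beta> T"
proof -
  obtain \<gamma> S where B: "B = (\<gamma>, S)" by fastforce
  then have "S \<noteq> {}" using assms(1,2) cells_subset_nbrs(2) by fastforce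
  then show ?thesis using assms(3) by (auto simp: B cell_form_def face_def)
qed

lemma pvar_hub_dvd_E:
  assumes "1 \<le> i" "T \<noteq> {hub (\<not> \<beta>)}"
  shows "pvar (hub \<beta>) dvd E i v \<beta> T"
  unfolding embed_def
  by (intro dvd_sum dvd_mult pvar_hub_dvd_cell_form[OF cell_in_cells assms]) simp

lemma E_at_cell:
  fixes v :: "nat \<Rightarrow> 'k::comm_ring_1 mpoly"
  assumes "(\<beta>, S) \<in> cells i" "S \<noteq> {}" "S \<noteq> {hub (\<not> \<beta>)}"
  shows "E i v \<beta> S = pvar (hub \<beta>) * v (cell_index i (\<beta>, S))"
proof -
  have "basis_form i p \<beta> S = (if p = cell_index i (\<beta>, S) then pvar (hub \<beta>) else 0 :: 'k mpoly)"
    if "p < rank i" for p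
  proof -
    have "p = cell_index i (\<beta>, S) \<longleftrightarrow> cell i p = (\<beta>, S)"
      using cell_index_cell[OF that] cell_cell_index[OF assms(1)] by auto
    then show ?thesis
      using assms(2,3) by (cases "cell i p") (auto simp: cell_form_def face_def)
  qed
  then have "E i v \<beta> S = (\<Sum>p<rank i. if p = cell_index i (\<beta>, S) then v p * pvar (hub \<beta>) else 0)"
    unfolding embed_def by (intro sum.cong) auto
  then show ?thesis
    using cell_index_less[OF assms(1)] by (simp add: mult.commute)
qed

lemma E_eq_0_imp:
  fixes v :: "nat \<Rightarrow> 'k::comm_ring_1 mpoly"
  assumes v: "v \<in> fmod V rank i" and E0: "\<And>\<beta>. E i v \<beta> = (\<lambda>_. 0)"
  shows "v = (\<lambda>_. 0)"
proof
  fix p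
  have unglued: "v q = 0" if "q < rank i" "1 \<le> i" "cell i q \<noteq> (False, {hub True})" for q
  proof -
    obtain \<beta> S where B: "cell i q = (\<beta>, S)" by fastforce
    with that(1) have BS: "(\<beta>, S) \<in> cells i" using cell_in_cells by metis
    have "pvar (hub \<beta>) * v q = E i v \<beta> S"
      using E_at_cell[OF BS cells_unglued[OF BS that(2)], of v] cell_index_cell[OF that(1)] that(3) B
      by simp
    then show ?thesis by (simp add: E0 pvar_mult_eq_0)
  qed
  consider "rank i \<le> p" | "p < rank i" "i = 0"
    | "p < rank i" "1 \<le> i" "cell i p \<noteq> (False, {hub True})"
    | "p < rank i" "1 \<le> i" "cell i p = (False, {hub True})"
    by linarith
  then show "v p = 0"
  proof cases
    case 1
    then show ?thesis by (rule fmodD(2)[OF v])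
  next
    case 2
    have "E 0 v False {} = v 0" by (simp add: embed_def rank_0 basis_form_0 face_def One_nat_def)
    with 2 E0[of False] show ?thesis by (simp add: rank_0 One_nat_def)
  next
    case 4
    have "v q = 0" if "q < rank i" "q \<noteq> p" for q
      using that 4 unglued cell_index_cell by metis
    then have "E i v False {hub True}
        = (\<Sum>q<rank i. if q = p then v p * basis_form i p False {hub True} else 0)"
      unfolding embed_def by (intro sum.cong) auto
    then have "pvar (hub False) * v p = 0"
      using 4 E0[of False] by (simp add: cell_form_def face_def mult.commute)
    then show ?thesis by (simp add: pvar_mult_eq_0)
  qed (rule unglued)
qed

lemma E_surj:
  fixes f :: "bool \<Rightarrow> vtx set \<Rightarrow> 'k::comm_ring_1 mpoly"
  assumes "2 \<le> i" "\<And>\<beta>. f \<beta> \<in> ext_power (nbrs \<beta>) i" "\<And>\<beta> S. f \<beta> S \<in> polyring V"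
    "\<And>\<beta> S. pvar (hub \<beta>) dvd f \<beta> S"
  obtains v where "v \<in> fmod V rank i" "\<And>\<beta>. E i v \<beta> = f \<beta>"
proof
  let ?v = "\<lambda>p. if p < rank i then case cell i p of (\<beta>, S) \<Rightarrow> pdiv (hub \<beta>) (f \<beta> S) else 0"
  show "?v \<in> fmod V rank i"
    using assms(3) by (auto simp: fmod_def split: prod.split)
  show "E i ?v \<beta> = f \<beta>" for \<beta>
  proof
    fix S
    show "E i ?v \<beta> S = f \<beta> S"
    proof (cases "S \<subseteq> nbrs \<beta> \<and> card S = i")
      case True
      then have S: "S \<noteq> {}" "S \<noteq> {hub (\<not> \<beta>)}" using assms(1) by auto
      with True have "(\<beta>, S) \<in> cells i" by (simp add: mem_cells)
      then show ?thesis
        using S by (simp add: E_at_cell cell_cell_index cell_index_less pvar_mult_pdiv assms(4))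
    next
      case False
      have "E i ?v \<beta> \<in> ext_power (nbrs \<beta>) i"
        by (intro embed_in_ext_power basis_form_in_ext_power)
      with False show ?thesis
        using ext_power_eq_0[of "E i ?v \<beta>"] ext_power_eq_0[OF assms(2)] by simp
    qed
  qed
qed

definition boundary_coeff :: "bool \<Rightarrow> vtx set \<Rightarrow> bool \<times> vtx set \<Rightarrow> 'k::comm_ring_1 mpoly" where
  "boundary_coeff \<beta> S B = (if B \<in> range (glue \<beta>)
     then koszul_diff (nbrs \<beta>) pvar (face S) (inv (glue \<beta>) B) else 0)"

text \<open>The form of the empty cell lacks the factor \<open>hub \<beta>\<close> that the other forms have on their own
  side, hence the extra factor in degree 1.\<close>

definition differential :: "nat \<Rightarrow> nat \<Rightarrow> nat \<Rightarrow> 'k::comm_ring_1 mpoly" where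
  "differential i p q = (case cell i q of (\<beta>, S) \<Rightarrow>
     (if i = 1 then pvar (hub \<beta>) else 1) * boundary_coeff \<beta> S (cell (i - 1) p))"

lemma boundary_coeff_glue: "boundary_coeff \<beta> S (glue \<beta> T) = koszul_diff (nbrs \<beta>) pvar (face S) T"
  by (simp add: boundary_coeff_def inj_glue)

lemma polyring_differential: "(differential i p q :: 'k::comm_ring_1 mpoly) \<in> polyring V"
proof -
  have "(boundary_coeff \<beta> S B :: 'k mpoly) \<in> polyring V" for \<beta> S B
    by (auto simp: boundary_coeff_def face_def intro!: polyring_koszul_diff polyring_pvar_nbr)
  then show ?thesis by (simp add: differential_def polyring_mult split: prod.split)
qed

lemma homogeneous_differential:
  "homogeneous (if i = 1 then 2 else 1) (differential i p q :: 'k::comm_ring_1 mpoly)"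
proof -
  have "homogeneous 1 (boundary_coeff \<beta> S B :: 'k mpoly)" for \<beta> S B
    by (simp add: boundary_coeff_def homogeneous_koszul_diff_face)
  moreover from this
  have "homogeneous (1 + 1) (pvar (hub \<beta>) * boundary_coeff \<beta> S B :: 'k mpoly)" for \<beta> S B
    by (rule homogeneous_mult[OF homogeneous_pvar])
  ultimately show ?thesis by (simp add: differential_def split: prod.split)
qed

lemma sum_boundary_coeff:
  fixes g :: "bool \<times> vtx set \<Rightarrow> 'k::comm_ring_1 mpoly"
  assumes "S \<subseteq> nbrs \<beta>" "card S = Suc i"
  shows "(\<Sum>B\<in>cells i. boundary_coeff \<beta> S B * g B)
    = (\<Sum>T\<in>Pow (nbrs \<beta>). koszul_diff (nbrs \<beta>) pvar (face S) T * g (glue \<beta> T))"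
proof -
  let ?K = "koszul_diff (nbrs \<beta>) pvar (face S) :: vtx set \<Rightarrow> 'k mpoly"
  let ?T = "{T. T \<subseteq> nbrs \<beta> \<and> card T = i}"
  have K: "?K \<in> ext_power (nbrs \<beta>) i"
    using assms by (intro koszul_diff_in_ext_power face_in_ext_power) auto
  have "(\<Sum>B\<in>cells i. boundary_coeff \<beta> S B * g B) = (\<Sum>B\<in>glue \<beta> ` ?T. boundary_coeff \<beta> S B * g B)"
  proof (rule sum.mono_neutral_right[OF finite_cells])
    show "glue \<beta> ` ?T \<subseteq> cells i" using glue_in_cells by auto
    show "\<forall>B\<in>cells i - glue \<beta> ` ?T. boundary_coeff \<beta> S B * g B = 0"
    proof
      fix B assume B: "B \<in> cells i - glue \<beta> ` ?T"
      have "boundary_coeff \<beta> S B = (0 :: 'k mpoly)"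
      proof (cases "B \<in> range (glue \<beta>)")
        case True
        then obtain T where T: "B = glue \<beta> T" by blast
        with B have "\<not> (T \<subseteq> nbrs \<beta> \<and> card T = i)" by blast
        with T show ?thesis using ext_power_eq_0[OF K] by (simp add: boundary_coeff_glue)
      qed (simp add: boundary_coeff_def)
      then show "boundary_coeff \<beta> S B * g B = 0" by simp
    qed
  qed
  also have "\<dots> = (\<Sum>T\<in>?T. ?K T * g (glue \<beta> T))"
    by (subst sum.reindex) (simp_all add: inj_on_subset[OF inj_glue] boundary_coeff_glue)
  also have "\<dots> = (\<Sum>T\<in>Pow (nbrs \<beta>). ?K T * g (glue \<beta> T))"
    using ext_power_eq_0[OF K] by (intro sum.mono_neutral_left) auto
  finally show ?thesis .
qed

lemma E_differential_eq:
  assumes "1 \<le> i" "q < rank i" "cell i q = (\<beta>, S)"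
  shows "E (i - 1) (\<lambda>p. differential i p q) \<delta> U
    = (if i = 1 then pvar (hub \<beta>) else 1 :: 'k::comm_ring_1 mpoly)
      * (\<Sum>T\<in>Pow (nbrs \<beta>). koszul_diff (nbrs \<beta>) pvar (face S) T * cell_form (\<beta>, T) \<delta> U)"
proof -
  let ?c = "if i = 1 then pvar (hub \<beta>) else 1 :: 'k mpoly"
  have "(\<beta>, S) \<in> cells i" using cell_in_cells[OF assms(2)] assms(3) by simp
  then have S: "S \<subseteq> nbrs \<beta>" "card S = Suc (i - 1)" using cells_subset_nbrs assms(1) by fastforce+
  have "E (i - 1) (\<lambda>p. differential i p q) \<delta> U
      = ?c * (\<Sum>p<rank (i - 1). boundary_coeff \<beta> S (cell (i - 1) p) * cell_form (cell (i - 1) p) \<delta> U)"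
    unfolding embed_def differential_def assms(3) by (simp add: sum_distrib_left mult.assoc)
  also have "\<dots> = ?c * (\<Sum>B\<in>cells (i - 1). boundary_coeff \<beta> S B * cell_form B \<delta> U)"
    unfolding sum.reindex_bij_betw[OF bij_betw_cell,
        where g = "\<lambda>B. boundary_coeff \<beta> S B * cell_form B \<delta> U"] ..
  finally show ?thesis unfolding sum_boundary_coeff[OF S] cell_form_glue .
qed

lemma E_differential_1:
  assumes "q < rank 1"
  shows "E 0 (\<lambda>p. differential 1 p q) \<delta> U
    = koszul_diff (nbrs \<delta>) pvar (basis_form 1 q \<delta> :: _ \<Rightarrow> 'k::comm_ring_1 mpoly) U"
proof -
  obtain \<beta> S where B: "cell 1 q = (\<beta>, S)" by fastforce
  then have "(\<beta>, S) \<in> cells 1" using cell_in_cells[OF assms] by simp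
  then obtain s where s: "S = {s}" "s \<in> nbrs \<beta>"
    using cells_subset_nbrs[of \<beta> S 1] by (auto elim: card_1_singletonE)
  have "(\<Sum>T\<in>Pow (nbrs \<beta>). koszul_diff (nbrs \<beta>) pvar (face S) T * cell_form (\<beta>, T) \<delta> U)
      = (\<Sum>T\<in>Pow (nbrs \<beta>). if T = {} then pvar s * face {} U else 0 :: 'k mpoly)"
    by (rule sum.cong) (auto simp: s koszul_diff_gen face_def cell_form_def)
  then have "E 0 (\<lambda>p. differential 1 p q) \<delta> U = (pvar (hub \<beta>) * (pvar s * face {} U) :: 'k mpoly)"
    using E_differential_eq[OF _ assms B, of \<delta> U, where 'k = 'k] by simp
  also have "\<dots> = koszul_diff (nbrs \<delta>) pvar (basis_form 1 q \<delta>) U"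
  proof (cases "\<beta> = \<delta>")
    case True
    then have "basis_form 1 q \<delta> = (\<lambda>T. pvar (hub \<beta>) * face {s} T :: 'k mpoly)"
      by (simp add: B s cell_form_def)
    then show ?thesis using s True by (simp add: koszul_diff_scale koszul_diff_gen)
  next
    case False
    then have "\<beta> = (\<not> \<delta>)" by simp
    have "basis_form 1 q \<delta> = (\<lambda>T. pvar s * face {hub \<beta>} T :: 'k mpoly)"
      using False by (simp add: B s cell_form_def fun_eq_iff)
    then show ?thesis
      using \<open>\<beta> = (\<not> \<delta>)\<close> by (simp add: koszul_diff_scale koszul_diff_gen mult.left_commute)
  qed
  finally show ?thesis .
qed

lemma koszul_boundary_own_side:
  assumes "S \<subseteq> nbrs \<beta>" "2 \<le> card S"
  shows "(\<Sum>T\<in>Pow (nbrs \<beta>). koszul_diff (nbrs \<beta>) pvar (face S) T * cell_form (\<beta>, T) \<beta> U)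
    = (koszul_diff (nbrs \<beta>) pvar (cell_form (\<beta>, S) \<beta>) U :: 'k::comm_ring_1 mpoly)"
proof -
  have "S \<noteq> {}" using assms(2) by auto
  let ?K = "koszul_diff (nbrs \<beta>) pvar (face S) :: _ \<Rightarrow> 'k mpoly"
  have K: "?K \<in> ext_power (nbrs \<beta>) (card S - 1)"
    using assms by (intro koszul_diff_in_ext_power face_in_ext_power) auto
  have "?K {} = 0" using assms(2) by (intro ext_power_eq_0[OF K]) auto
  then have "(\<Sum>T\<in>Pow (nbrs \<beta>). ?K T * cell_form (\<beta>, T) \<beta> U)
      = (\<Sum>T\<in>Pow (nbrs \<beta>). pvar (hub \<beta>) * (?K T * face T U))"
    by (intro sum.cong) (auto simp: cell_form_def)
  also have "\<dots> = pvar (hub \<beta>) * ?K U"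
    using fun_cong[OF ext_power_face_expansion[OF finite_nbrs K], of U] by (simp add: sum_distrib_left)
  also have "\<dots> = koszul_diff (nbrs \<beta>) pvar (\<lambda>T. pvar (hub \<beta>) * face S T) U"
    by (rule koszul_diff_scale[symmetric])
  also have "(\<lambda>T. pvar (hub \<beta>) * face S T) = (cell_form (\<beta>, S) \<beta> :: _ \<Rightarrow> 'k mpoly)"
    using \<open>S \<noteq> {}\<close> by (simp add: cell_form_def)
  finally show ?thesis .
qed

lemma koszul_boundary_other_side:
  assumes "S \<subseteq> nbrs \<beta>" "2 \<le> card S" "\<beta> \<noteq> \<delta>"
  shows "(\<Sum>T\<in>Pow (nbrs \<beta>). koszul_diff (nbrs \<beta>) pvar (face S) T * cell_form (\<beta>, T) \<delta> U)
    = (0 :: 'k::comm_ring_1 mpoly)"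
proof -
  let ?K = "koszul_diff (nbrs \<beta>) pvar (face S) :: _ \<Rightarrow> 'k mpoly"
  have K: "?K \<in> ext_power (nbrs \<beta>) (card S - 1)"
    using assms by (intro koszul_diff_in_ext_power face_in_ext_power) auto
  have "?K T * cell_form (\<beta>, T) \<delta> U = 0" if "T \<in> Pow (nbrs \<beta>) - (\<lambda>t. {t}) ` nbrs \<beta>" for T
  proof (cases "T = {}")
    case True
    then show ?thesis using assms(2) ext_power_eq_0[OF K, of "{}"] by simp
  next
    case False
    moreover have "card T \<noteq> 1" using that by (auto elim!: card_1_singletonE)
    ultimately show ?thesis using assms(3) by (simp add: cell_form_def)
  qed
  then have "(\<Sum>T\<in>Pow (nbrs \<beta>). ?K T * cell_form (\<beta>, T) \<delta> U)
      = (\<Sum>T\<in>(\<lambda>t. {t}) ` nbrs \<beta>. ?K T * cell_form (\<beta>, T) \<delta> U)"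
    by (intro sum.mono_neutral_right) auto
  also have "\<dots> = (\<Sum>t\<in>nbrs \<beta>. pvar t * ?K {t}) * face {hub \<beta>} U"
    using assms(3) by (subst sum.reindex) (simp_all add: cell_form_def sum_distrib_left ac_simps)
  also have "(\<Sum>t\<in>nbrs \<beta>. pvar t * ?K {t}) = koszul_diff (nbrs \<beta>) pvar ?K {}"
    by (simp add: koszul_diff_def[of _ _ ?K] contract_def)
  finally show ?thesis by (simp add: koszul_diff_koszul_diff)
qed

lemma E_differential_ge2:
  assumes "2 \<le> i" "q < rank i"
  shows "E (i - 1) (\<lambda>p. differential i p q) \<delta> U
    = koszul_diff (nbrs \<delta>) pvar (basis_form i q \<delta> :: _ \<Rightarrow> 'k::comm_ring_1 mpoly) U"
proof -
  obtain \<beta> S where B: "cell i q = (\<beta>, S)" by fastforce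
  then have "(\<beta>, S) \<in> cells i" using cell_in_cells[OF assms(2)] by simp
  then have S: "S \<subseteq> nbrs \<beta>" "2 \<le> card S" using cells_subset_nbrs assms(1) by auto
  have E_eq: "E (i - 1) (\<lambda>p. differential i p q) \<delta> U = (\<Sum>T\<in>Pow (nbrs \<beta>).
      koszul_diff (nbrs \<beta>) pvar (face S) T * cell_form (\<beta>, T) \<delta> U :: 'k mpoly)"
    using E_differential_eq[OF _ assms(2) B, of \<delta> U, where 'k = 'k] assms(1) by simp
  show ?thesis
  proof (cases "\<beta> = \<delta>")
    case True
    then show ?thesis using E_eq koszul_boundary_own_side[OF S, of U, where 'k = 'k] by (simp add: B)
  next
    case False
    moreover have "S \<noteq> {}" using S(2) by auto
    ultimately have "basis_form i q \<delta> = (\<lambda>_. 0 :: 'k mpoly)"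
      using S(2) by (simp add: B cell_form_def)
    then show ?thesis
      using E_eq koszul_boundary_other_side[OF S False, of U, where 'k = 'k]
      by (simp add: koszul_diff_def contract_def)
  qed
qed

sublocale embedded: embedded_complex V rank differential nbrs "\<lambda>_. pvar" basis_form
proof
  show "E (i - 1) (\<lambda>p. differential i p q) \<beta> = koszul_diff (nbrs \<beta>) pvar (basis_form i q \<beta>)"
    if "1 \<le> i" "q < rank i" for i q \<beta>
    using that E_differential_1[of q \<beta>] E_differential_ge2[of i q \<beta>] by (cases "i = 1") auto
qed (use E_eq_0_imp polyring_differential basis_form_in_ext_power in auto)

lemma pvar_hub_dvd_E_cycle:
  fixes v :: "nat \<Rightarrow> 'k::comm_ring_1 mpoly"
  assumes "1 \<le> i" "diff differential rank i v = (\<lambda>_. 0)"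
  shows "pvar (hub \<beta>) dvd E i v \<beta> S"
proof (cases "i = 1 \<and> S = {hub (\<not> \<beta>)}")
  case True
  let ?h = "hub (\<not> \<beta>)"
  have "(\<Sum>s\<in>nbrs \<beta>. pvar s * E 1 v \<beta> {s}) = koszul_diff (nbrs \<beta>) pvar (E 1 v \<beta>) {}"
    by (simp add: koszul_diff_def contract_def)
  also have "\<dots> = 0"
    using embedded.koszul_diff_E_cycle[OF assms(2), of \<beta>] True by simp
  finally have "pvar ?h * E 1 v \<beta> {?h} = - (\<Sum>s\<in>nbrs \<beta> - {?h}. pvar s * E 1 v \<beta> {s})"
    by (simp add: sum.remove[OF finite_nbrs hub_in_nbrs] eq_neg_iff_add_eq_0)
  moreover have "pvar (hub \<beta>) dvd (\<Sum>s\<in>nbrs \<beta> - {?h}. pvar s * E 1 v \<beta> {s})"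
    by (intro dvd_sum dvd_mult pvar_hub_dvd_E) auto
  ultimately have "pvar (hub \<beta>) dvd pvar ?h * E 1 v \<beta> {?h}" by simp
  then show ?thesis using True by (simp add: pvar_dvd_pvar_mult_iff)
next
  case False
  show ?thesis
  proof (cases "S = {hub (\<not> \<beta>)}")
    case True
    then have "E i v \<beta> S = 0"
      using False by (intro ext_power_eq_0[OF embedded.E_in_ext_power]) auto
    then show ?thesis by simp
  qed (rule pvar_hub_dvd_E[OF assms(1)])
qed

lemma cycle_hub_multipleE:
  fixes v :: "nat \<Rightarrow> 'k::comm_ring_1 mpoly"
  assumes "1 \<le> i" and v: "v \<in> fmod V rank i" and cycle: "diff differential rank i v = (\<lambda>_. 0)"
  obtains u where "\<And>\<beta>. E i v \<beta> = (\<lambda>S. pvar (hub \<beta>) * u \<beta> S)"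
    "\<And>\<beta>. u \<beta> \<in> ext_power (nbrs \<beta>) i" "\<And>\<beta> S. u \<beta> S \<in> polyring V"
    "\<And>\<beta>. koszul_diff (nbrs \<beta>) pvar (u \<beta>) = (\<lambda>_. 0)"
proof
  let ?u = "\<lambda>\<beta> S. pdiv (hub \<beta>) (E i v \<beta> S)"
  show E_v: "E i v \<beta> = (\<lambda>S. pvar (hub \<beta>) * ?u \<beta> S)" for \<beta>
    using pvar_hub_dvd_E_cycle[OF assms(1) cycle] by (simp add: pvar_mult_pdiv)
  show "?u \<beta> \<in> ext_power (nbrs \<beta>) i" for \<beta>
    unfolding ext_power_def
  proof (intro CollectI allI impI)
    fix S assume "?u \<beta> S \<noteq> 0"
    then have "E i v \<beta> S \<noteq> 0" by auto
    then show "S \<subseteq> nbrs \<beta> \<and> card S = i"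
      using embedded.E_in_ext_power[of i v \<beta>] by (simp add: ext_power_def)
  qed
  show "?u \<beta> S \<in> polyring V" for \<beta> S
    unfolding embed_def
    by (intro polyring_pdiv polyring_sum polyring_mult fmodD(1)[OF v]
        polyring_cell_form[OF cell_in_cells]) simp
  show "koszul_diff (nbrs \<beta>) pvar (?u \<beta>) = (\<lambda>_. 0)" for \<beta>
  proof
    fix U
    have "pvar (hub \<beta>) * koszul_diff (nbrs \<beta>) pvar (?u \<beta>) U = koszul_diff (nbrs \<beta>) pvar (E i v \<beta>) U"
      by (subst (2) E_v) (simp only: koszul_diff_scale)
    then show "koszul_diff (nbrs \<beta>) pvar (?u \<beta>) U = 0"
      unfolding embedded.koszul_diff_E_cycle[OF cycle] by (simp add: pvar_mult_eq_0)
  qed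
qed

lemma cycle_is_boundary:
  fixes v :: "nat \<Rightarrow> 'k::comm_ring_1 mpoly"
  assumes "1 \<le> i" and v: "v \<in> fmod V rank i" and cycle: "diff differential rank i v = (\<lambda>_. 0)"
  shows "v \<in> diff differential rank (i + 1) ` fmod V rank (i + 1)"
proof -
  obtain n where i: "i = Suc n" using assms(1) by (cases i) auto
  obtain u where E_v: "\<And>\<beta>. E i v \<beta> = (\<lambda>S. pvar (hub \<beta>) * u \<beta> S)"
    and u: "\<And>\<beta>. u \<beta> \<in> ext_power (nbrs \<beta>) i" "\<And>\<beta> S. u \<beta> S \<in> polyring V"
      "\<And>\<beta>. koszul_diff (nbrs \<beta>) pvar (u \<beta>) = (\<lambda>_. 0)"
    using cycle_hub_multipleE[OF assms] by blast
  let ?w = "\<lambda>\<beta>. koszul_cone (nbrs \<beta>) (u \<beta>)"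
  have dw: "koszul_diff (nbrs \<beta>) pvar (?w \<beta>) = u \<beta>" for \<beta>
    using u(1,3) unfolding i by (intro koszul_exact[OF finite_nbrs]) auto
  obtain v' where v': "v' \<in> fmod V rank (i + 1)" "\<And>\<beta>. E (i + 1) v' \<beta> = (\<lambda>S. pvar (hub \<beta>) * ?w \<beta> S)"
  proof (rule E_surj[of "i + 1" "\<lambda>\<beta> S. pvar (hub \<beta>) * ?w \<beta> S"])
    show "2 \<le> i + 1" using assms(1) by simp
    show "(\<lambda>S. pvar (hub \<beta>) * ?w \<beta> S) \<in> ext_power (nbrs \<beta>) (i + 1)" for \<beta>
      unfolding Suc_eq_plus1[symmetric]
      by (intro ext_power_scale koszul_cone_in_ext_power[OF finite_nbrs] u(1))
    show "pvar (hub \<beta>) * ?w \<beta> S \<in> polyring V" for \<beta> S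
      by (intro polyring_mult polyring_pvar_hub polyring_koszul_cone u(2))
  qed auto
  have "diff differential rank (i + 1) v' = v"
  proof (rule embedded.E_inject[OF _ v])
    show "diff differential rank (i + 1) v' \<in> fmod V rank i"
      using embedded.diff_in_fmod[OF v'(1)] by simp
    show "E i (diff differential rank (i + 1) v') \<beta> U = E i v \<beta> U" for \<beta> U
      using embedded.E_diff[of "i + 1" v' \<beta>] by (simp add: v'(2) koszul_diff_scale dw E_v)
  qed
  then show ?thesis using v'(1) by blast
qed

definition edge :: "bool \<times> vtx set \<Rightarrow> vtx \<times> vtx" where
  "edge = (\<lambda>(\<beta>, S). (hub \<beta>, the_elem S))"

lemma bij_betw_edge: "bij_betw edge (cells 1) (Ledges a b c)"
proof -
  have "{S. S \<subseteq> nbrs \<beta> \<and> card S = 1} = (\<lambda>s. {s}) ` nbrs \<beta>" for \<beta>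
    by (auto elim!: card_1_singletonE)
  then have cells_1: "cells 1 = (\<Union>\<beta>. (\<lambda>s. glue \<beta> {s}) ` nbrs \<beta>)" by (simp add: cells_def image_image)
  have "inj_on edge (cells 1)"
    by (auto simp: cells_1 inj_on_def edge_def glue_def split: if_splits)
  moreover have "edge ` cells 1 = Ledges a b c"
  proof -
    have "edge (glue \<beta> {s}) = (if s = hub (\<not> \<beta>) then (VX, VY) else (hub \<beta>, s))" for \<beta> s
      by (simp add: edge_def glue_def hub_def)
    then have "edge ` cells 1 = (\<Union>\<beta>. (\<lambda>s. if s = hub (\<not> \<beta>) then (VX, VY) else (hub \<beta>, s)) ` nbrs \<beta>)"
      by (simp add: cells_1 image_UN image_image)
    also have "\<dots> = Ledges a b c"
      by (auto simp: UNIV_bool nbrs_def hub_def Ledges_def image_Un image_image)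
    finally show ?thesis .
  qed
  ultimately show ?thesis by (simp add: bij_betw_def)
qed

lemma differential_1:
  assumes "q < rank 1"
  shows "(differential 1 p q :: 'k::comm_ring_1 mpoly)
    = var_mono (fst (edge (cell 1 q))) (snd (edge (cell 1 q)))"
proof -
  obtain \<beta> S where B: "cell 1 q = (\<beta>, S)" by fastforce
  then have "(\<beta>, S) \<in> cells 1" using cell_in_cells[OF assms] by simp
  then obtain s where s: "S = {s}" "s \<in> nbrs \<beta>"
    using cells_subset_nbrs[of \<beta> S 1] by (auto elim: card_1_singletonE)
  have "boundary_coeff \<beta> S (cell 0 p) = (pvar s :: 'k mpoly)"
    using boundary_coeff_glue[of \<beta> S "{}"] s
    by (simp add: cell_0 glue_def koszul_diff_gen face_def)
  then show ?thesis
    by (simp add: differential_def B edge_def s var_mono_def pvar_def mult_single)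
qed

lemma image_diff_1:
  "(\<lambda>v. v 0) ` (diff differential rank 1 ` fmod V rank 1)
    = (edge_ideal a b c :: 'k::comm_ring_1 mpoly set)"
proof -
  let ?m = "\<lambda>(s, t). var_mono s t :: 'k mpoly"
  have edge_cell: "bij_betw (edge \<circ> cell 1) {..<rank 1} (Ledges a b c)"
    by (rule bij_betw_trans[OF bij_betw_cell bij_betw_edge])
  have diff_edge_sum: "diff differential rank 1 v 0 = (\<Sum>x\<in>Ledges a b c. g x * ?m x)"
    if "\<And>q. q < rank 1 \<Longrightarrow> v q = g (edge (cell 1 q))" for v g
  proof -
    have "diff differential rank 1 v 0 = (\<Sum>q<rank 1. g ((edge \<circ> cell 1) q) * ?m ((edge \<circ> cell 1) q))"
      by (simp add: diff_def rank_0 differential_1 that case_prod_unfold mult.commute)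
    also have "\<dots> = (\<Sum>x\<in>Ledges a b c. g x * ?m x)"
      by (rule sum.reindex_bij_betw[OF edge_cell])
    finally show ?thesis .
  qed
  show ?thesis
  proof (intro equalityI subsetI)
    fix x :: "'k mpoly" assume "x \<in> (\<lambda>v. v 0) ` (diff differential rank 1 ` fmod V rank 1)"
    then obtain v :: "nat \<Rightarrow> 'k mpoly"
      where v: "v \<in> fmod V rank 1" "x = diff differential rank 1 v 0" by blast
    let ?g = "v \<circ> inv_into {..<rank 1} (edge \<circ> cell 1)"
    have "?g (edge (cell 1 q)) = v q" if "q < rank 1" for q
      using inv_into_f_f[OF bij_betw_imp_inj_on[OF edge_cell], of q] that by simp
    then have "x = (\<Sum>y\<in>Ledges a b c. ?g y * ?m y)"
      unfolding v(2) by (intro diff_edge_sum) simp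
    then show "x \<in> edge_ideal a b c"
      unfolding edge_ideal_def case_prod_unfold using fmodD(1)[OF v(1)] by auto
  next
    fix x :: "'k mpoly" assume "x \<in> edge_ideal a b c"
    then obtain g where g: "\<And>y. g y \<in> polyring V" "x = (\<Sum>y\<in>Ledges a b c. g y * ?m y)"
      unfolding edge_ideal_def case_prod_unfold by blast
    let ?v = "\<lambda>q. if q < rank 1 then g (edge (cell 1 q)) else 0"
    have "?v \<in> fmod V rank 1" using g(1) by (simp add: fmod_def del: split_paired_All)
    moreover have "x = diff differential rank 1 ?v 0"
      unfolding g(2) by (rule diff_edge_sum[symmetric]) simp
    ultimately show "x \<in> (\<lambda>v. v 0) ` (diff differential rank 1 ` fmod V rank 1)" by blast
  qed
qed

theorem minimal_free_resolution_edge_ideal: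
  "minimal_free_resolution V (edge_ideal a b c) rank
    (differential :: _ \<Rightarrow> _ \<Rightarrow> _ \<Rightarrow> 'k::comm_ring_1 mpoly)"
  unfolding minimal_free_resolution_def
proof (intro conjI allI impI)
  show "rank 0 = 1" by (rule rank_0)
  show "differential i p q \<in> polyring V" for i p q by (rule polyring_differential)
  show "(\<lambda>v. v 0) ` (diff differential rank 1 ` fmod V rank 1) = edge_ideal a b c"
    by (rule image_diff_1)
  show "{v \<in> fmod V rank i. diff differential rank i v = (\<lambda>_. 0 :: 'k mpoly)}
      = diff differential rank (i + 1) ` fmod V rank (i + 1)" if "1 \<le> i" for i
    using cycle_is_boundary[OF that] embedded.diff_diff[of _ "i + 1"]
      embedded.diff_in_fmod[of _ "i + 1"] by auto
  let ?deg = "\<lambda>i p. if i = 0 then 0 else i + 1 :: nat"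
  have "?deg (i - 1) p \<le> ?deg i q \<and>
      homogeneous (?deg i q - ?deg (i - 1) p) (differential i p q :: 'k mpoly)" if "1 \<le> i" for i p q
    using homogeneous_differential[of i p q, where 'k = 'k] that by (auto split: if_splits)
  then show "\<exists>dg :: nat \<Rightarrow> nat \<Rightarrow> nat. dg 0 0 = 0 \<and>
      (\<forall>i p q. 1 \<le> i \<longrightarrow> p < rank (i - 1) \<longrightarrow> q < rank i \<longrightarrow> (differential i p q :: 'k mpoly) = 0 \<or>
        (dg (i - 1) p \<le> dg i q \<and> homogeneous (dg i q - dg (i - 1) p) (differential i p q :: 'k mpoly)))"
    by (intro exI[of _ ?deg]) simp
  show "lookup (differential i p q :: 'k mpoly) 0 = 0" for i p q
    by (rule homogeneous_lookup_0[OF homogeneous_differential[of i]]) simp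
qed

section \<open>The multiplication\<close>

lemma basis_product:
  assumes "p < rank i" "q < rank j"
  obtains m where "m \<in> fmod V rank (i + j)"
    "\<And>\<beta>. E (i + j) m \<beta> = wedge (basis_form i p \<beta>) (basis_form j q \<beta> :: _ \<Rightarrow> 'k::comm_ring_1 mpoly)"
proof -
  consider "i = 0" | "j = 0" | "1 \<le> i" "1 \<le> j" by linarith
  then show ?thesis
  proof cases
    case 1
    show ?thesis
    proof (rule that[OF unit_vec_in_fmod[of q]])
      show "E (i + j) (unit_vec q) \<beta>
          = wedge (basis_form i p \<beta>) (basis_form j q \<beta> :: _ \<Rightarrow> 'k mpoly)" for \<beta>
        using 1 assms(2)
        by (simp add: embed_unit_vec basis_form_0
            wedge_one_left[OF finite_nbrs basis_form_in_ext_power])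
    qed (use 1 assms(2) in simp)
  next
    case 2
    show ?thesis
    proof (rule that[OF unit_vec_in_fmod[of p]])
      show "E (i + j) (unit_vec p) \<beta>
          = wedge (basis_form i p \<beta>) (basis_form j q \<beta> :: _ \<Rightarrow> 'k mpoly)" for \<beta>
        using 2 assms(1)
        by (simp add: embed_unit_vec basis_form_0
            wedge_one_right[OF finite_nbrs basis_form_in_ext_power])
    qed (use 2 assms(1) in simp)
  next
    case 3
    let ?f = "\<lambda>\<beta>. wedge (basis_form i p \<beta>) (basis_form j q \<beta>) :: _ \<Rightarrow> 'k mpoly"
    show ?thesis
    proof (rule E_surj[of "i + j" ?f])
      show "2 \<le> i + j" using 3 by simp
      show "?f \<beta> \<in> ext_power (nbrs \<beta>) (i + j)" for \<beta>
        by (intro wedge_in_ext_power finite_nbrs basis_form_in_ext_power assms)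
      show "?f \<beta> S \<in> polyring V" for \<beta> S
        unfolding wedge_def using assms
        by (auto intro!: polyring_sum polyring_mult polyring_cell_form cell_in_cells)
      show "pvar (hub \<beta>) dvd ?f \<beta> S" for \<beta> S
        by (intro dvd_wedge pvar_hub_dvd_cell_form[OF cell_in_cells[OF assms(1)] 3(1)]
            pvar_hub_dvd_cell_form[OF cell_in_cells[OF assms(2)] 3(2)])
    qed (rule that)
  qed
qed

theorem dg_algebra_structure_exists:
  "\<exists>mu. dg_algebra_structure V rank (differential :: _ \<Rightarrow> _ \<Rightarrow> _ \<Rightarrow> 'k::comm_ring_1 mpoly) mu"
proof -
  define is_product where "is_product i j p q m \<longleftrightarrow> (\<forall>s. m s \<in> polyring V) \<and>
    (p < rank i \<longrightarrow> q < rank j \<longrightarrow>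
      (\<forall>\<beta>. E (i + j) m \<beta> = wedge (basis_form i p \<beta>) (basis_form j q \<beta> :: _ \<Rightarrow> 'k mpoly)))"
    for i j p q m
  have "\<exists>m. is_product i j p q m" for i j p q
  proof (cases "p < rank i \<and> q < rank j")
    case True
    then obtain m where "m \<in> fmod V rank (i + j)"
      "\<And>\<beta>. E (i + j) m \<beta> = wedge (basis_form i p \<beta>) (basis_form j q \<beta> :: _ \<Rightarrow> 'k mpoly)"
      using basis_product by blast
    then have "is_product i j p q m" by (simp add: is_product_def fmodD(1))
    then show ?thesis by blast
  next
    case False
    then have "is_product i j p q (\<lambda>_. 0)" by (auto simp: is_product_def)
    then show ?thesis by blast
  qed
  then obtain mu where mu: "\<And>i j p q. is_product i j p q (mu i j p q)" by metis
  interpret embedded_dg_algebra V rank differential nbrs "\<lambda>_. pvar" basis_form mu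
    using mu by unfold_locales (auto simp: is_product_def rank_0 basis_form_0)
  show ?thesis using dg_algebra_structure by blast
qed

end

theorem mainTheorem4:
  fixes a b c :: nat
  shows "\<exists>(r :: nat \<Rightarrow> nat) (d :: nat \<Rightarrow> nat \<Rightarrow> nat \<Rightarrow> ('k::field) mpoly).
           minimal_free_resolution (Lverts a b c) (edge_ideal a b c) r d \<and>
           (\<exists>mu. dg_algebra_structure (Lverts a b c) r d mu)"
  using Lgraph.minimal_free_resolution_edge_ideal Lgraph.dg_algebra_structure_exists by blast

end
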